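(* Consider the constrained problem $F^\star:=\min_{x\in\mathbb{R}^p}\{F(x)=f(x)+g(x)\mid Ax=c\}$, with $f,g,A,c$ as in the context, let $x^\star$ be an optimal solution, and let $y^\star$ be an arbitrary optimal solution of its dual problem $\max_{y\in\mathbb{R}^m}\{\min_{x\in\mathbb{R}^p}F(x)+\langle Ax,y\rangle-\langle c,y\rangle\}$. Let $\{\bar x^k\}$ be the sequence generated by the constrained SMART-CD algorithm described in the context, and let $\tau_0:=\min\{q_i\mid i\in[n]\}\in(0,1]$ and $\beta_0:=(1+\tau_0)\beta_1$. Then for all $k\ge1$ $$\mathbb{E}\left[F(\bar x^k)-F^\star\right]\le\frac{C^*(x^0)}{\tau_0(k-1)+1}+\frac{\beta_1\|y^\star-\dot y\|^2}{2(\tau_0(k-1)+1)}+\|y^\star\|\,\mathbb{E}\left[\|A\bar x^k-c\|\right],$$ $$\mathbb{E}\left[\|A\bar x^k-c\|\right]\le\frac{\beta_1}{\tau_0(k-1)+1}\left[\|y^\star-\dot y\|+\left(\|y^\star-\dot y\|^2+2\beta_1^{-1}C^*(x^0)\right)^{1/2}\right],$$ where $$C^*(x^0):=(1-\tau_0)\left(F_{\beta_0}(x^0)-F^\star\right)+\sum_{i=1}^n\frac{\tau_0B_i^0}{2q_i}\|x_i^\star-x_i^0\|_{(i)}^2 .$$ Moreover, the lower bound $-\|y^\star\|\,\mathbb{E}[\|A\bar x^k-c\|]\le\mathbb{E}[F(\bar x^k)-F^\star]$ always holds.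
   Context: **Notation.** $[n]=\{1,\dots,n\}$. Vectors $x\in\mathbb{R}^p$ are split into $n$ blocks $x=[x_1;\dots;x_n]$ with $x_i\in\mathbb{R}^{p_i}$, $p_i\ge1$, $\sum_i p_i=p$; the identity is split as $\mathbb{I}_p=[U_1,\dots,U_n]$ with $U_i\in\mathbb{R}^{p\times p_i}$, so $x_i=U_i^\top x$; $\nabla_if(x)=U_i^\top\nabla f(x)$. $A\in\mathbb{R}^{m\times p}$ is a given matrix, $A_i\in\mathbb{R}^{m\times p_i}$ is its $i$-th column block, and $c\in\mathbb{R}^m$ is given. $\|\cdot\|$ denotes $\|\cdot\|_2$: the Euclidean norm for vectors and, for the matrices $A_i$, the spectral norm. For each $i$, $H_i\in\mathbb{R}^{p_i\times p_i}$ is a given symmetric positive definite matrix, $\|x_i\|_{(i)}^2=\langle H_ix_i,x_i\rangle$ and $(\|y_i\|_{(i)}^* )^2=\langle H_i^{-1}y_i,y_i\rangle$. **Assumptions on the problem.** $f:\mathbb{R}^p\to\mathbb{R}$ and $g:\mathbb{R}^p\to\mathbb{R}\cup\{+\infty\}$ are proper, closed and convex. $f$ is differentiable and for each $i$ there is $\hat L_i\in[0,\infty)$ with $\|\nabla_if(x+U_id_i)-\nabla_if(x)\|_{(i)}^*\le\hat L_i\|d_i\|_{(i)}$ for all $x\in\mathbb{R}^p$, $d_i\in\mathbb{R}^{p_i}$. $g$ is separable: $g(x)=\sum_{i=1}^ng_i(x_i)$. **Smoothing.** The constraint is encoded by $h=\delta_{\{c\}}$, the indicator function of $\{c\}$ (so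 its Fenchel conjugate is $h^*(y)=\langle c,y\rangle$). Fix $\dot y\in\mathbb{R}^m$. For $\beta>0$, $h_\beta(u):=\max_{y\in\mathbb{R}^m}\{\langle u-c,y\rangle-\frac{\beta}{2}\|y-\dot y\|^2\}$, and $F_\beta(x):=f(x)+g(x)+h_\beta(Ax)$. **Constrained SMART-CD algorithm.** Inputs: $\beta_1>0$, $\alpha\in[0,1]$, $x^0\in\mathbb{R}^p$. Set $B_i^0:=\hat L_i+\|A_i\|^2/\beta_1$ for $i\in[n]$, $S_\alpha:=\sum_{i=1}^n(B_i^0)^\alpha$, $q_i:=(B_i^0)^\alpha/S_\alpha$ (with $q_i>0$ for all $i$), $\tau_0:=\min_iq_i$, $\bar x^0=\tilde x^0:=x^0$. For $k=0,1,2,\dots$: 1. $\hat x^k:=(1-\tau_k)\bar x^k+\tau_k\tilde x^k$. 2. $y_k^*:=\dot y+\frac{1}{\beta_{k+1}}(A\hat x^k-c)$. 3. Draw $i_k\in[n]$ with $\mathbb{P}\{i_k=i\}=q_i$, independently of the previous draws. 4. Set $\tilde x^{k+1}:=\tilde x^k$ except for block $i_k$, where $\tilde x_{i_k}^{k+1}:=\arg\min_{x_{i_k}\in\mathbb{R}^{p_{i_k}}}\{\langle\nabla_{i_k}f(\hat x^k)+A_{i_k}^\top y_k^*,x_{i_k}-\hat x_{i_k}^k\rangle+g_{i_k}(x_{i_k})+\frac{\tau_kB_{i_k}^k}{2\tau_0}\|x_{i_k}-\tilde x_{i_k}^k\|_{(i_k)}^2\}$. 5. $\bar x^{k+1}:=\hat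 x^k+\frac{\tau_k}{\tau_0}(\tilde x^{k+1}-\tilde x^k)$. 6. $\tau_{k+1}:=\frac{\tau_k}{1+\tau_k}$. 7. $\beta_{k+2}:=(1-\tau_{k+1})\beta_{k+1}$ and $B_i^{k+1}:=\hat L_i+\|A_i\|^2/\beta_{k+2}$ for $i\in[n]$. $\mathbb{E}$ is expectation over the random indices $i_0,i_1,\dots$.
   Formalization: The formal theorem additionally assumes strong duality (the dual value at y* equals F* ) and ‖A_i d‖ ≤ ‖A_i‖‖d‖_(i) for every block vector d (true when H_i = I or H_i − I is positive semidefinite); without either assumption the claim is false. *)

theory Defs
  imports "HOL-Probability.Probability"
begin

section \<open>Extended-real-valued convex functions and expectations\<close>

definition ext_epigraph :: "('a::euclidean_space \<Rightarrow> ereal) \<Rightarrow> ('a \<times> real) set" where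
  "ext_epigraph \<phi> = {(x, r). \<phi> x \<le> ereal r}"

definition proper_closed_convex :: "('a::euclidean_space \<Rightarrow> ereal) \<Rightarrow> bool" where
  "proper_closed_convex \<phi> \<longleftrightarrow>
     (\<forall>x. \<phi> x \<noteq> -\<infinity>) \<and> (\<exists>x. \<phi> x \<noteq> \<infinity>) \<and>
     closed (ext_epigraph \<phi>) \<and> convex (ext_epigraph \<phi>)"

definition gradient :: "('a::euclidean_space \<Rightarrow> real) \<Rightarrow> 'a \<Rightarrow> 'a" where
  "gradient \<phi> x = (THE D. GDERIV \<phi> x :> D)"

text \<open>
  The objective may take the value \<open>+\<infinity>\<close>, so its expectation is the difference of the
  integrals of the positive and the negative part (\<open>e2ennreal\<close> maps negative numbers to 0).
\<close>

definition ext_expectation :: "'w measure \<Rightarrow> ('w \<Rightarrow> ereal) \<Rightarrow> ereal" where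
  "ext_expectation M X =
     enn2ereal (\<integral>\<^sup>+\<omega>. e2ennreal (X \<omega>) \<partial>M) - enn2ereal (\<integral>\<^sup>+\<omega>. e2ennreal (- X \<omega>) \<partial>M)"

definition ext_sqrt :: "ereal \<Rightarrow> ereal" where
  "ext_sqrt x = (if x = \<infinity> then \<infinity> else ereal (sqrt (real_of_ereal x)))"


section \<open>Problem data\<close>

text \<open>
  The coordinates of \<open>\<real>\<^sup>p\<close> are indexed by \<open>'p\<close>, the blocks by \<open>'n\<close>, and \<open>blk j\<close> is the block
  containing coordinate \<open>j\<close>.  An element of \<open>\<real>\<close> to the power \<open>p\<^sub>i\<close> is represented by its image
  under \<open>U\<^sub>i\<close>, that is, by a vector of \<open>\<real>\<^sup>p\<close> that vanishes outside block \<open>i\<close> (\<open>block_space\<close>);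
  correspondingly \<open>block_proj\<close> is \<open>U\<^sub>i U\<^sub>i\<^sup>T\<close>.

  The matrices \<open>H\<^sub>i\<close> are the diagonal blocks of one block diagonal matrix \<open>Hmat\<close>.  Symmetry,
  definiteness and inversion of \<open>Hmat\<close> are then blockwise, so \<open>block_norm\<close> and \<open>block_dual_norm\<close>
  restricted to block \<open>i\<close> are the weighted norm with matrix \<open>H\<^sub>i\<close> and its dual.

  Only the values of \<open>gfun i\<close> on the \<open>i\<close>-th block space are ever used.
\<close>

record ('p, 'n, 'm) cd_problem =
  blk :: "'p \<Rightarrow> 'n"
  ffun :: "real^'p \<Rightarrow> real"
  gfun :: "'n \<Rightarrow> real^'p \<Rightarrow> ereal"
  Amat :: "real^'p^'m"
  cvec :: "real^'m"
  Hmat :: "real^'p^'p"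
  Lhat :: "'n \<Rightarrow> real"
  ydot :: "real^'m"
  beta1 :: real
  alpha :: real
  xinit :: "real^'p"

definition block_space ::
    "('p::finite, 'n::finite, 'm::finite) cd_problem \<Rightarrow> 'n \<Rightarrow> (real^'p) set" where
  "block_space P i = {z. \<forall>j. blk P j \<noteq> i \<longrightarrow> z $ j = 0}"

definition block_proj ::
    "('p::finite, 'n::finite, 'm::finite) cd_problem \<Rightarrow> 'n \<Rightarrow> real^'p \<Rightarrow> real^'p" where
  "block_proj P i x = (\<chi> j. if blk P j = i then x $ j else 0)"

definition block_matrix ::
    "('p::finite, 'n::finite, 'm::finite) cd_problem \<Rightarrow> 'n \<Rightarrow> real^'p^'m" where
  "block_matrix P i = (\<chi> r j. if blk P j = i then Amat P $ r $ j else 0)"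

definition block_spectral_norm ::
    "('p::finite, 'n::finite, 'm::finite) cd_problem \<Rightarrow> 'n \<Rightarrow> real" where
  "block_spectral_norm P i = onorm (\<lambda>x. block_matrix P i *v x)"

definition block_diagonal_spd ::
    "('p::finite, 'n::finite, 'm::finite) cd_problem \<Rightarrow> bool" where
  "block_diagonal_spd P \<longleftrightarrow>
     (\<forall>j l. blk P j \<noteq> blk P l \<longrightarrow> Hmat P $ j $ l = 0) \<and>
     transpose (Hmat P) = Hmat P \<and>
     (\<forall>x. x \<noteq> 0 \<longrightarrow> (Hmat P *v x) \<bullet> x > 0)"

definition block_norm ::
    "('p::finite, 'n::finite, 'm::finite) cd_problem \<Rightarrow> real^'p \<Rightarrow> real" where
  "block_norm P z = sqrt ((Hmat P *v z) \<bullet> z)"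

definition block_dual_norm ::
    "('p::finite, 'n::finite, 'm::finite) cd_problem \<Rightarrow> real^'p \<Rightarrow> real" where
  "block_dual_norm P z = sqrt ((matrix_inv (Hmat P) *v z) \<bullet> z)"

definition gtotal ::
    "('p::finite, 'n::finite, 'm::finite) cd_problem \<Rightarrow> real^'p \<Rightarrow> ereal" where
  "gtotal P x = (\<Sum>i\<in>UNIV. gfun P i (block_proj P i x))"

definition objective ::
    "('p::finite, 'n::finite, 'm::finite) cd_problem \<Rightarrow> real^'p \<Rightarrow> ereal" where
  "objective P x = ereal (ffun P x) + gtotal P x"

definition opt_value :: "('p::finite, 'n::finite, 'm::finite) cd_problem \<Rightarrow> ereal" where
  "opt_value P = (INF x \<in> {x. Amat P *v x = cvec P}. objective P x)"

definition dual_objective ::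
    "('p::finite, 'n::finite, 'm::finite) cd_problem \<Rightarrow> real^'m \<Rightarrow> ereal" where
  "dual_objective P y =
     (INF x. objective P x + ereal ((Amat P *v x) \<bullet> y) - ereal (cvec P \<bullet> y))"

definition block_lipschitz :: "('p::finite, 'n::finite, 'm::finite) cd_problem \<Rightarrow> bool" where
  "block_lipschitz P \<longleftrightarrow>
     (\<forall>i. 0 \<le> Lhat P i \<and>
        (\<forall>x. \<forall>d\<in>block_space P i.
           block_dual_norm P (block_proj P i (gradient (ffun P) (x + d))
               - block_proj P i (gradient (ffun P) x))
             \<le> Lhat P i * block_norm P d))"


section \<open>Smoothing\<close>

definition h_smooth ::
    "('p::finite, 'n::finite, 'm::finite) cd_problem \<Rightarrow> real \<Rightarrow> real^'m \<Rightarrow> real" where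
  "h_smooth P \<beta> u = (SUP y. (u - cvec P) \<bullet> y - \<beta> / 2 * (norm (y - ydot P))\<^sup>2)"

definition F_smooth ::
    "('p::finite, 'n::finite, 'm::finite) cd_problem \<Rightarrow> real \<Rightarrow> real^'p \<Rightarrow> ereal" where
  "F_smooth P \<beta> x = objective P x + ereal (h_smooth P \<beta> (Amat P *v x))"


section \<open>The algorithm\<close>

definition step_const ::
    "('p::finite, 'n::finite, 'm::finite) cd_problem \<Rightarrow> real \<Rightarrow> 'n \<Rightarrow> real" where
  "step_const P \<beta> i = Lhat P i + (block_spectral_norm P i)\<^sup>2 / \<beta>"

text \<open>\<open>0 powr 0 = 0\<close> in HOL, whereas \<open>\<alpha> = 0\<close> has to give the uniform distribution.\<close>

definition weight ::
    "('p::finite, 'n::finite, 'm::finite) cd_problem \<Rightarrow> 'n \<Rightarrow> real" where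
  "weight P i = (if alpha P = 0 then 1 else step_const P (beta1 P) i powr alpha P)"

definition qprob ::
    "('p::finite, 'n::finite, 'm::finite) cd_problem \<Rightarrow> 'n \<Rightarrow> real" where
  "qprob P i = weight P i / (\<Sum>j\<in>UNIV. weight P j)"

definition tau0 :: "('p::finite, 'n::finite, 'm::finite) cd_problem \<Rightarrow> real" where
  "tau0 P = Min (range (qprob P))"

primrec tau :: "('p::finite, 'n::finite, 'm::finite) cd_problem \<Rightarrow> nat \<Rightarrow> real" where
  "tau P 0 = tau0 P"
| "tau P (Suc k) = tau P k / (1 + tau P k)"

fun beta :: "('p::finite, 'n::finite, 'm::finite) cd_problem \<Rightarrow> nat \<Rightarrow> real" where
  "beta P 0 = (1 + tau0 P) * beta1 P"
| "beta P (Suc 0) = beta1 P"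
| "beta P (Suc (Suc k)) = (1 - tau P (Suc k)) * beta P (Suc k)"

definition Bconst ::
    "('p::finite, 'n::finite, 'm::finite) cd_problem \<Rightarrow> nat \<Rightarrow> 'n \<Rightarrow> real" where
  "Bconst P k i = step_const P (beta P (Suc k)) i"

definition xhat_of ::
    "('p::finite, 'n::finite, 'm::finite) cd_problem \<Rightarrow> nat \<Rightarrow> real^'p \<Rightarrow> real^'p \<Rightarrow> real^'p" where
  "xhat_of P k xb xt = (1 - tau P k) *\<^sub>R xb + tau P k *\<^sub>R xt"

definition ystar_of ::
    "('p::finite, 'n::finite, 'm::finite) cd_problem \<Rightarrow> nat \<Rightarrow> real^'p \<Rightarrow> real^'m" where
  "ystar_of P k xh = ydot P + (1 / beta P (Suc k)) *\<^sub>R (Amat P *v xh - cvec P)"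

definition block_subproblem ::
    "('p::finite, 'n::finite, 'm::finite) cd_problem \<Rightarrow> nat \<Rightarrow> 'n
       \<Rightarrow> real^'p \<Rightarrow> real^'p \<Rightarrow> real^'p \<Rightarrow> ereal" where
  "block_subproblem P k i xh xt z =
     ereal ((block_proj P i (gradient (ffun P) xh)
              + transpose (block_matrix P i) *v ystar_of P k xh) \<bullet> (z - block_proj P i xh))
     + gfun P i z
     + ereal (tau P k * Bconst P k i / (2 * tau0 P)
              * (block_norm P (z - block_proj P i xt))\<^sup>2)"

definition xtilde_step ::
    "('p::finite, 'n::finite, 'm::finite) cd_problem \<Rightarrow> nat \<Rightarrow> 'n
       \<Rightarrow> real^'p \<Rightarrow> real^'p \<Rightarrow> real^'p" where
  "xtilde_step P k i xh xt =
     xt - block_proj P i xt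
        + arg_min (block_subproblem P k i xh xt) (\<lambda>z. z \<in> block_space P i)"

text \<open>
  \<open>iterate P \<iota> k\<close> is the pair of the averaged iterate (bar) and the prox iterate (tilde) after
  \<open>k\<close> steps when the blocks drawn are \<open>\<iota> 0, \<iota> 1, \<dots>\<close>; it depends only on \<open>\<iota> 0, \<dots>, \<iota> (k - 1)\<close>.
\<close>

primrec iterate ::
    "('p::finite, 'n::finite, 'm::finite) cd_problem \<Rightarrow> (nat \<Rightarrow> 'n) \<Rightarrow> nat
       \<Rightarrow> (real^'p) \<times> (real^'p)" where
  "iterate P \<iota> 0 = (xinit P, xinit P)"
| "iterate P \<iota> (Suc k) =
     (let xb = fst (iterate P \<iota> k);
          xt = snd (iterate P \<iota> k);
          xh = xhat_of P k xb xt;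
          xt' = xtilde_step P k (\<iota> k) xh xt
      in (xh + (tau P k / tau0 P) *\<^sub>R (xt' - xt), xt'))"

definition xbar ::
    "('p::finite, 'n::finite, 'm::finite) cd_problem \<Rightarrow> (nat \<Rightarrow> 'n) \<Rightarrow> nat \<Rightarrow> real^'p" where
  "xbar P \<iota> k = fst (iterate P \<iota> k)"

text \<open>
  \<open>Cstar\<close> is infinite when the objective is infinite at the initial point, except that
  \<open>0 * \<infinity> = 0\<close> when \<open>tau0 P = 1\<close>.
\<close>

definition Cstar ::
    "('p::finite, 'n::finite, 'm::finite) cd_problem \<Rightarrow> real^'p \<Rightarrow> ereal" where
  "Cstar P xs =
     ereal (1 - tau0 P) * (F_smooth P (beta P 0) (xinit P) - opt_value P)
     + ereal (\<Sum>i\<in>UNIV. tau0 P * Bconst P 0 i / (2 * qprob P i)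
                * (block_norm P (block_proj P i (xs - xinit P)))\<^sup>2)"


section \<open>Compatibility of the norms\<close>

text \<open>
  The step constants contain the spectral norm of \<open>A\<^sub>i\<close>, while the prox step is measured in the
  norm weighted by \<open>H\<^sub>i\<close>.  This condition relates the two; it holds for every \<open>A\<close> if
  \<open>H\<^sub>i - I\<close> is positive semidefinite, in particular for \<open>H\<^sub>i = I\<close>.  It cannot be dropped: take
  \<open>f = g = 0\<close>, \<open>p = n = m = 1\<close>, \<open>A = 1\<close>, \<open>c = ydot = 0\<close>, \<open>H = 1/10\<close>.  Then the first
  iterate is \<open>-9\<close> times the initial point, whereas the feasibility bound is \<open>sqrt (1/10)\<close> times
  the norm of the initial point.
\<close>

definition spectral_norm_compatible ::
    "('p::finite, 'n::finite, 'm::finite) cd_problem \<Rightarrow> bool" where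
  "spectral_norm_compatible P \<longleftrightarrow>
     (\<forall>i. \<forall>d\<in>block_space P i. norm (Amat P *v d) \<le> block_spectral_norm P i * block_norm P d)"

end

theory Submission
  imports Defs
begin

text \<open>
  The proof follows one scalar quantity along the algorithm, the smoothed gap
  \<open>f (xbar\<^sub>k) + g (xbar\<^sub>k) + h\<^sub>\<beta> (A xbar\<^sub>k) - F\<^sup>*\<close> with \<open>\<beta> = beta\<^sub>k\<close>, and shows that its expectation decays like
  \<open>Cstar / (\<tau>\<^sub>0 (k - 1) + 1)\<close>.  Both bounds of the theorem are read off from this single rate.

  Decay of the gap.  The smoothed constraint \<open>h\<^sub>\<beta> (A x)\<close> is an explicit quadratic function
  (\<open>h_smooth_eq\<close>), so \<open>f + h\<^sub>\<beta> (A \<cdot>)\<close> satisfies a descent inequality along every block whose constant is the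
  step constant of the algorithm (\<open>smoothed_block_descent\<close>).  The block update minimises the linearised
  objective plus a quadratic term.  Comparing its value with the value at the point that lies the
  fraction \<open>\<tau>\<^sub>0 / q\<^sub>i\<close> of the way from the current block to the optimal block (\<open>single_block_progress\<close>), and
  then averaging over the drawn block, makes the probabilities \<open>q\<^sub>i\<close> cancel (\<open>expected_progress\<close>).
  Convexity of \<open>f\<close> and a perfect square coming from the penalty (\<open>extrapolation_bound\<close>) then give
  \<open>E [gap\<^bsub>k+1\<^esub> + \<tau>\<^sub>k V\<^sub>k (xtilde\<^bsub>k+1\<^esub>)] \<le> (1 - \<tau>\<^sub>k) gap\<^sub>k + \<tau>\<^sub>k V\<^sub>k (xtilde\<^sub>k)\<close>, where \<open>V\<^sub>k\<close> is a weighted squared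
  distance to the optimal point, and where the square absorbs the decrease of the smoothing parameter.
  Since \<open>(1 - \<tau>\<^bsub>k+1\<^esub>) / \<tau>\<^bsub>k+1\<^esub> = 1 / \<tau>\<^sub>k\<close> and the weights of \<open>V\<^sub>k\<close> decrease, \<open>gap\<^bsub>k+1\<^esub> / \<tau>\<^sub>k + V\<^sub>k\<close> is a
  supermartingale (\<open>lyapunov_step\<close>), whose initial value gives \<open>Cstar / \<tau>\<^sub>0\<close>.

  In this recursion \<open>g (xbar\<^sub>k)\<close> is replaced by an upper bound, the combination of the values of \<open>g\<close> at the prox
  iterates with the coefficients by which \<open>xbar\<^sub>k\<close> is composed of them (\<open>surrogate_bound\<close>).  These
  coefficients are nonnegative from the first step on.

  Reading off the bounds.  Strong duality says that \<open>F (x) + \<langle>A x - c, y\<^sup>*\<rangle> \<ge> F\<^sup>*\<close> for all \<open>x\<close>, which is the lower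
  bound.  Inserting it into the gap gives a quadratic inequality for the expected residual
  (\<open>expected_residual\<close>), and bounding the penalty from below by its value at \<open>y\<^sup>*\<close> gives the upper bound
  on the objective (\<open>expected_objective_upper\<close>).

  Two points need care.  The subproblems must have solutions: the optimality of \<open>x\<^sup>*\<close> supplies an affine minorant
  of each block of \<open>g\<close> (\<open>gblock_subgradient\<close>), and when a step constant vanishes, \<open>x\<^sup>*\<close> itself solves the
  subproblem (\<open>prox_minimizer_degenerate\<close>).  And \<open>g\<close> may be infinite at the initial point: then \<open>Cstar\<close> is
  infinite, unless \<open>\<tau>\<^sub>0 = 1\<close>, in which case there is one block and the initial value of \<open>g\<close> is
  forgotten after the first step.
\<close>

section \<open>Differentiable convex functions\<close>

text \<open>
  The gradient is defined by a definite description, so the Riesz representative of the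
  derivative has to be shown to exist and to be unique before the gradient means anything.
\<close>

lemma gderiv_gradient:
  fixes f :: "'a::euclidean_space \<Rightarrow> real"
  assumes "f differentiable (at x)"
  shows "GDERIV f x :> gradient f x"
proof -
  from assms obtain f' where f': "(f has_derivative f') (at x)"
    by (auto simp: differentiable_def)
  then interpret f': bounded_linear f' by (rule has_derivative_bounded_linear)
  have "f' = (\<lambda>h. h \<bullet> (\<Sum>b\<in>Basis. f' b *\<^sub>R b))"
  proof
    fix h :: 'a
    have "f' h = f' (\<Sum>b\<in>Basis. (h \<bullet> b) *\<^sub>R b)" by (simp add: euclidean_representation)
    also have "\<dots> = h \<bullet> (\<Sum>b\<in>Basis. f' b *\<^sub>R b)"
      by (simp add: f'.sum f'.scaleR inner_sum_right mult.commute)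
    finally show "f' h = h \<bullet> (\<Sum>b\<in>Basis. f' b *\<^sub>R b)" .
  qed
  with f' have D: "GDERIV f x :> (\<Sum>b\<in>Basis. f' b *\<^sub>R b)"
    by (simp add: gderiv_def)
  have "D1 = D2" if "GDERIV f x :> D1" "GDERIV f x :> D2" for D1 D2
  proof -
    have "(\<lambda>h. h \<bullet> D1) = (\<lambda>h. h \<bullet> D2)"
      using that by (auto simp: gderiv_def intro: has_derivative_unique)
    then show ?thesis by (metis vector_eq_ldot)
  qed
  then show ?thesis
    unfolding gradient_def using D by (intro theI[of "\<lambda>D. GDERIV f x :> D"])
qed

lemma gradient_line_derivative:
  fixes f :: "'a::euclidean_space \<Rightarrow> real"
  assumes "\<And>x. f differentiable (at x)"
  shows "((\<lambda>t. f (x + t *\<^sub>R d)) has_real_derivative (gradient f (x + t *\<^sub>R d) \<bullet> d)) (at t within S)"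
proof -
  have "(f has_derivative (\<lambda>h. h \<bullet> gradient f (x + t *\<^sub>R d))) (at (x + t *\<^sub>R d))"
    using gderiv_gradient[OF assms] by (simp add: gderiv_def)
  moreover have "((\<lambda>t. x + t *\<^sub>R d) has_derivative (\<lambda>s. s *\<^sub>R d)) (at t within S)"
    by (auto intro!: derivative_eq_intros)
  ultimately have "((\<lambda>t. f (x + t *\<^sub>R d)) has_derivative (\<lambda>s. (s *\<^sub>R d) \<bullet> gradient f (x + t *\<^sub>R d))) (at t within S)"
    by (rule has_derivative_compose[rotated])
  then show ?thesis
    by (simp add: has_field_derivative_def inner_commute mult_commute_abs)
qed

lemma convex_above_gradient:
  fixes f :: "'a::euclidean_space \<Rightarrow> real"
  assumes "\<And>x. f differentiable (at x)" "convex_on UNIV f"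
  shows "f x + gradient f x \<bullet> (y - x) \<le> f y"
proof -
  let ?\<phi> = "\<lambda>t. f (x + t *\<^sub>R (y - x))"
  have "convex_on UNIV ?\<phi>"
  proof (rule convex_onI)
    fix t a b :: real assume t: "0 < t" "t < 1"
    have "x + ((1 - t) * a + t * b) *\<^sub>R (y - x)
        = (1 - t) *\<^sub>R (x + a *\<^sub>R (y - x)) + t *\<^sub>R (x + b *\<^sub>R (y - x))"
      by (simp add: algebra_simps)
    then show "?\<phi> ((1 - t) *\<^sub>R a + t *\<^sub>R b) \<le> (1 - t) * ?\<phi> a + t * ?\<phi> b"
      using convex_onD[OF assms(2), of t] t by simp
  qed simp
  from convex_on_imp_above_tangent[OF this, of 0 1 "gradient f x \<bullet> (y - x)"]
  show ?thesis
    using gradient_line_derivative[OF assms(1), of x "y - x" 0] by simp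
qed

lemma convex_on_of_ext_epigraph:
  assumes "proper_closed_convex (\<lambda>x. ereal (f x))"
  shows "convex_on UNIV f"
proof -
  have "epigraph UNIV f = ext_epigraph (\<lambda>x. ereal (f x))"
    by (auto simp: epigraph_def ext_epigraph_def)
  then show ?thesis
    using assms by (metis convex_epigraph proper_closed_convex_def)
qed

section \<open>Symmetric positive definite forms\<close>

lemma spd_cauchy_schwarz:
  fixes H :: "real^'p^'p"
  assumes sym: "transpose H = H" and pd: "\<And>x. x \<noteq> 0 \<Longrightarrow> 0 < (H *v x) \<bullet> x"
  shows "(H *v v) \<bullet> w \<le> sqrt ((H *v v) \<bullet> v) * sqrt ((H *v w) \<bullet> w)"
proof (cases "w = 0")
  case False
  let ?a = "(H *v v) \<bullet> v" and ?b = "(H *v v) \<bullet> w" and ?c = "(H *v w) \<bullet> w"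
  have sw: "(H *v w) \<bullet> v = ?b"
    by (metis dot_lmul_matrix inner_commute sym transpose_matrix_vector)
  have nn: "0 \<le> (H *v x) \<bullet> x" for x using pd[of x] by (cases "x = 0") auto
  have c: "0 < ?c" using pd False by simp
  have "0 \<le> (H *v (v - (?b / ?c) *\<^sub>R w)) \<bullet> (v - (?b / ?c) *\<^sub>R w)" by (rule nn)
  also have "\<dots> = ?a - 2 * (?b / ?c) * ?b + (?b / ?c)\<^sup>2 * ?c"
    using sw by (simp add: algebra_simps matrix_vector_mult_diff_distrib matrix_vector_mult_scaleR power2_eq_square)
  also have "\<dots> = ?a - ?b\<^sup>2 / ?c" using c by (simp add: power2_eq_square field_simps)
  finally have "?b\<^sup>2 \<le> ?a * ?c" using c by (simp add: field_simps)
  then have "\<bar>?b\<bar> \<le> sqrt (?a * ?c)" by (metis real_sqrt_abs real_sqrt_le_mono)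
  then show ?thesis by (simp add: real_sqrt_mult)
qed simp

lemma spd_coercive:
  fixes H :: "real^'p^'p"
  assumes pd: "\<And>x. x \<noteq> 0 \<Longrightarrow> 0 < (H *v x) \<bullet> x"
  obtains l where "0 < l" "\<And>x. l * (norm x)\<^sup>2 \<le> (H *v x) \<bullet> x"
proof -
  have cont: "continuous_on (sphere 0 1) (\<lambda>x. (H *v x) \<bullet> x)"
    by (intro continuous_intros linear_continuous_on matrix_vector_mul_bounded_linear)
  have "sphere (0::real^'p) 1 \<noteq> {}" by simp
  then obtain u where u: "u \<in> sphere (0::real^'p) 1"
    and min: "\<And>x. x \<in> sphere 0 1 \<Longrightarrow> (H *v u) \<bullet> u \<le> (H *v x) \<bullet> x"
    using continuous_attains_inf[OF compact_sphere _ cont] by blast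
  show ?thesis
  proof
    show "0 < (H *v u) \<bullet> u" using u by (intro pd) auto
    fix x :: "real^'p"
    show "(H *v u) \<bullet> u * (norm x)\<^sup>2 \<le> (H *v x) \<bullet> x"
    proof (cases "x = 0")
      case False
      have "(H *v u) \<bullet> u \<le> (H *v ((1 / norm x) *\<^sub>R x)) \<bullet> ((1 / norm x) *\<^sub>R x)"
        using False by (intro min) simp
      also have "\<dots> = ((H *v x) \<bullet> x) / (norm x)\<^sup>2"
        by (simp add: matrix_vector_mult_scaleR power2_eq_square)
      finally show ?thesis using False by (simp add: field_simps)
    qed simp
  qed
qed

text \<open>
  With \<open>v = H u\<close> this is the Cauchy-Schwarz inequality of the inner product induced by \<open>H\<close>,
  because \<open>\<langle>H\<^bsup>-1\<^esup> v, v\<rangle> = \<langle>H u, u\<rangle>\<close>.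
\<close>

lemma spd_inverse_duality:
  fixes H :: "real^'p^'p"
  assumes sym: "transpose H = H" and pd: "\<And>x. x \<noteq> 0 \<Longrightarrow> 0 < (H *v x) \<bullet> x"
  shows "v \<bullet> w \<le> sqrt ((matrix_inv H *v v) \<bullet> v) * sqrt ((H *v w) \<bullet> w)"
proof -
  have "H *v x = 0 \<Longrightarrow> x = 0" for x using pd[of x] by fastforce
  then have "invertible H"
    by (metis invertible_left_inverse matrix_left_invertible_ker)
  then have "\<exists>H'. H ** H' = mat 1 \<and> H' ** H = mat 1" by (simp add: invertible_def)
  then have HH: "H ** matrix_inv H = mat 1" unfolding matrix_inv_def by (rule someI2_ex) simp
  define u where "u = matrix_inv H *v v"
  have v: "H *v u = v" unfolding u_def by (simp add: matrix_vector_mul_assoc HH)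
  have "(H *v u) \<bullet> w \<le> sqrt ((H *v u) \<bullet> u) * sqrt ((H *v w) \<bullet> w)"
    by (rule spd_cauchy_schwarz[OF sym pd])
  then show ?thesis by (simp add: v inner_commute flip: u_def)
qed

section \<open>Block decomposition\<close>

lemma linear_block_proj: "linear (block_proj P i)"
  by (rule linearI) (auto simp: block_proj_def vec_eq_iff)

lemma block_proj_add: "block_proj P i (x + y) = block_proj P i x + block_proj P i y"
  and block_proj_diff: "block_proj P i (x - y) = block_proj P i x - block_proj P i y"
  using linear_block_proj[of P i]
  by (auto simp: linear_add linear_diff linear_scale)

lemma block_proj_in [simp]: "block_proj P i x \<in> block_space P i"
  by (auto simp: block_proj_def block_space_def)

lemma block_proj_id: "z \<in> block_space P i \<Longrightarrow> block_proj P i z = z"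
  by (auto simp: block_proj_def block_space_def vec_eq_iff)

lemma block_proj_other: "z \<in> block_space P i \<Longrightarrow> j \<noteq> i \<Longrightarrow> block_proj P j z = 0"
  by (auto simp: block_proj_def block_space_def vec_eq_iff)

lemma sum_block_proj: "(\<Sum>i\<in>UNIV. block_proj P i x) = x"
  by (simp add: vec_eq_iff block_proj_def sum_component)

lemma inner_block_proj: "block_proj P i x \<bullet> y = x \<bullet> block_proj P i y"
  by (auto simp: inner_vec_def block_proj_def intro!: sum.cong)

lemma subspace_block_space: "subspace (block_space P i)"
  by (auto simp: subspace_def block_space_def)

lemma closed_block_space: "closed (block_space P i)"
  by (rule closed_subspace[OF subspace_block_space])

lemma transpose_block_matrix:
  "transpose (block_matrix P i) *v y = block_proj P i (transpose (Amat P) *v y)"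
  by (auto simp: vec_eq_iff block_matrix_def block_proj_def transpose_def matrix_vector_mult_def
      intro!: sum.neutral)

definition block_update ::
    "('p::finite, 'n::finite, 'm::finite) cd_problem \<Rightarrow> 'n \<Rightarrow> real^'p \<Rightarrow> real^'p \<Rightarrow> real^'p" where
  "block_update P i x z = x - block_proj P i x + z"

lemma block_proj_update:
  assumes "z \<in> block_space P i"
  shows "block_proj P j (block_update P i x z) = (if j = i then z else block_proj P j x)"
  using assms
  by (auto simp: block_update_def block_proj_add block_proj_diff block_proj_id block_proj_other
      block_proj_other[OF block_proj_in])

text \<open>
  Real-valued versions of the extended-valued nonsmooth terms.  They agree with those terms on
  the domains \<open>block_dom\<close> and \<open>gdom\<close>; an infinite value is read as 0.  In the rate estimates this
  happens only at the initial point when \<open>\<tau>\<^sub>0 = 1\<close>, and there the value has total coefficient 0.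
\<close>

definition gblock :: "('p::finite, 'n::finite, 'm::finite) cd_problem \<Rightarrow> 'n \<Rightarrow> real^'p \<Rightarrow> real" where
  "gblock P i z = real_of_ereal (gfun P i z)"

definition gval :: "('p::finite, 'n::finite, 'm::finite) cd_problem \<Rightarrow> real^'p \<Rightarrow> real" where
  "gval P x = (\<Sum>i\<in>UNIV. gblock P i (block_proj P i x))"

definition block_dom :: "('p::finite, 'n::finite, 'm::finite) cd_problem \<Rightarrow> 'n \<Rightarrow> (real^'p) set" where
  "block_dom P i = {z \<in> block_space P i. gfun P i z \<noteq> \<infinity>}"

definition gdom :: "('p::finite, 'n::finite, 'm::finite) cd_problem \<Rightarrow> (real^'p) set" where
  "gdom P = {x. \<forall>i. block_proj P i x \<in> block_dom P i}"

lemma sum_block_update: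
  fixes F :: "'n::finite \<Rightarrow> real^'p \<Rightarrow> real"
  assumes "z \<in> block_space P i"
  shows "(\<Sum>j\<in>UNIV. F j (block_proj P j (block_update P i x z)))
    = (\<Sum>j\<in>UNIV. F j (block_proj P j x)) + (F i z - F i (block_proj P i x))"
proof -
  have "(\<Sum>j\<in>UNIV. F j (block_proj P j (block_update P i x z)))
      = F i z + (\<Sum>j\<in>UNIV - {i}. F j (block_proj P j x))"
    by (subst sum.remove[of _ i]) (auto simp: block_proj_update[OF assms])
  moreover have "(\<Sum>j\<in>UNIV. F j (block_proj P j x))
      = F i (block_proj P i x) + (\<Sum>j\<in>UNIV - {i}. F j (block_proj P j x))"
    by (subst sum.remove[of _ i]) auto
  ultimately show ?thesis by simp
qed

lemma gval_update:
  assumes "z \<in> block_space P i"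
  shows "gval P (block_update P i x z) = gval P x + (gblock P i z - gblock P i (block_proj P i x))"
  unfolding gval_def by (rule sum_block_update[OF assms])

section \<open>Optimality of the primal-dual pair\<close>

text \<open>
  Strong duality makes \<open>(xstar, ystar)\<close> a saddle point of the Lagrangian; all uses of optimality below
  go through this fact.
\<close>

locale cd_optimum =
  fixes P :: "('p::finite, 'n::finite, 'm::finite) cd_problem"
    and xstar :: "real^'p" and ystar :: "real^'m"
  assumes H_spd: "block_diagonal_spd P"
    and f_pcc: "proper_closed_convex (\<lambda>x. ereal (ffun P x))"
    and f_diff: "\<And>x. ffun P differentiable (at x)"
    and f_lip: "block_lipschitz P"
    and g_not_MInf: "\<And>i z. z \<in> block_space P i \<Longrightarrow> gfun P i z \<noteq> -\<infinity>"
    and g_pcc: "proper_closed_convex (gtotal P)"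
    and beta1_pos: "0 < beta1 P"
    and q_pos: "\<And>i. 0 < qprob P i"
    and primal_opt: "is_arg_min (objective P) (\<lambda>x. Amat P *v x = cvec P) xstar"
    and strong_duality: "dual_objective P ystar = opt_value P"
    and norm_compat: "spectral_norm_compatible P"
begin

definition Fstar :: real where "Fstar = ffun P xstar + gval P xstar"

lemma H_sym: "transpose (Hmat P) = Hmat P"
  and H_pos: "x \<noteq> 0 \<Longrightarrow> 0 < (Hmat P *v x) \<bullet> x"
  using H_spd by (auto simp: block_diagonal_spd_def)

lemma H_nonneg: "0 \<le> (Hmat P *v x) \<bullet> x"
  using H_pos[of x] by (cases "x = 0") auto

lemma H_commute: "(Hmat P *v x) \<bullet> y = (Hmat P *v y) \<bullet> x"
  by (metis dot_lmul_matrix inner_commute H_sym transpose_matrix_vector)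

lemma block_norm_sq: "(block_norm P z)\<^sup>2 = (Hmat P *v z) \<bullet> z"
  using H_nonneg by (simp add: block_norm_def)

lemma block_norm_nonneg: "0 \<le> block_norm P z"
  using H_nonneg by (simp add: block_norm_def)

lemma block_norm_scaleR: "block_norm P (t *\<^sub>R z) = \<bar>t\<bar> * block_norm P z"
proof -
  have "(Hmat P *v (t *\<^sub>R z)) \<bullet> (t *\<^sub>R z) = t\<^sup>2 * ((Hmat P *v z) \<bullet> z)"
    by (simp add: matrix_vector_mult_scaleR power2_eq_square)
  then show ?thesis by (simp add: block_norm_def real_sqrt_mult)
qed

lemma block_norm_convex_combination:
  "(block_norm P ((1 - t) *\<^sub>R x + t *\<^sub>R y))\<^sup>2
     = (1 - t) * (block_norm P x)\<^sup>2 + t * (block_norm P y)\<^sup>2 - t * (1 - t) * (block_norm P (x - y))\<^sup>2"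
  using H_commute[of x y]
  by (simp add: block_norm_sq matrix_vector_right_distrib matrix_vector_mult_diff_distrib
      matrix_vector_mult_scaleR inner_add_left inner_add_right inner_diff_left inner_diff_right
      algebra_simps)

lemma f_convex: "convex_on UNIV (ffun P)"
  by (rule convex_on_of_ext_epigraph[OF f_pcc])

lemma f_tangent: "ffun P x + gradient (ffun P) x \<bullet> (y - x) \<le> ffun P y"
  by (rule convex_above_gradient[OF f_diff f_convex])

lemma Lhat_nonneg: "0 \<le> Lhat P i"
  using f_lip by (auto simp: block_lipschitz_def)

text \<open>
  The function \<open>f (x + t d) - t \<langle>\<nabla>f x, d\<rangle> - L t\<^sup>2 \<parallel>d\<parallel>\<^sup>2 / 2\<close> of \<open>t \<ge> 0\<close> has a nonpositive
  derivative by the blockwise Lipschitz condition and the duality of the two weighted norms.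
\<close>

lemma f_block_descent:
  assumes d: "d \<in> block_space P i"
  shows "ffun P (x + d) \<le> ffun P x + gradient (ffun P) x \<bullet> d + Lhat P i / 2 * (block_norm P d)\<^sup>2"
proof -
  let ?g = "\<lambda>x. gradient (ffun P) x"
  let ?N = "(block_norm P d)\<^sup>2"
  let ?\<phi> = "\<lambda>t::real. ffun P (x + t *\<^sub>R d) - t * (?g x \<bullet> d) - Lhat P i / 2 * t\<^sup>2 * ?N"
  have "?\<phi> 1 \<le> ?\<phi> 0"
  proof (rule DERIV_nonpos_imp_nonincreasing[of 0 1 ?\<phi>])
    fix t :: real assume t: "0 \<le> t" "t \<le> 1"
    have D: "(?\<phi> has_real_derivative (?g (x + t *\<^sub>R d) \<bullet> d - ?g x \<bullet> d - Lhat P i * t * ?N)) (at t)"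
      by (rule derivative_eq_intros gradient_line_derivative[OF f_diff] refl | simp)+
    have "?g (x + t *\<^sub>R d) \<bullet> d - ?g x \<bullet> d
        = (block_proj P i (?g (x + t *\<^sub>R d)) - block_proj P i (?g x)) \<bullet> d"
      by (simp add: inner_diff_left inner_block_proj block_proj_id[OF d])
    also have "\<dots> \<le> block_dual_norm P (block_proj P i (?g (x + t *\<^sub>R d)) - block_proj P i (?g x)) * block_norm P d"
      unfolding block_dual_norm_def block_norm_def
      by (rule spd_inverse_duality[OF H_sym H_pos])
    also have "\<dots> \<le> (Lhat P i * block_norm P (t *\<^sub>R d)) * block_norm P d"
      using f_lip subspace_scale[OF subspace_block_space d, of t]
      by (intro mult_right_mono block_norm_nonneg) (auto simp: block_lipschitz_def)
    also have "\<dots> = Lhat P i * t * ?N"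
      using t by (simp add: block_norm_scaleR power2_eq_square)
    finally show "\<exists>y. (?\<phi> has_real_derivative y) (at t) \<and> y \<le> 0"
      using D by (intro exI conjI) auto
  qed simp
  then show ?thesis by simp
qed

lemma gtotal_in: "x \<in> gdom P \<Longrightarrow> gtotal P x = ereal (gval P x)"
proof -
  assume x: "x \<in> gdom P"
  have "gfun P i (block_proj P i x) = ereal (gblock P i (block_proj P i x))" for i
    using x g_not_MInf[OF block_proj_in, of i x]
    by (auto simp: gdom_def block_dom_def gblock_def ereal_real)
  then show ?thesis by (simp add: gtotal_def gval_def)
qed

lemma gtotal_notin: "x \<notin> gdom P \<Longrightarrow> gtotal P x = \<infinity>"
proof -
  assume "x \<notin> gdom P"
  then obtain i where "gfun P i (block_proj P i x) = \<infinity>"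
    by (auto simp: gdom_def block_dom_def)
  then show ?thesis
    unfolding gtotal_def by (subst sum_Pinfty) auto
qed

lemma gtotal_le_iff: "gtotal P x \<le> ereal r \<longleftrightarrow> x \<in> gdom P \<and> gval P x \<le> r"
  by (cases "x \<in> gdom P") (auto simp: gtotal_in gtotal_notin)

lemma objective_in: "x \<in> gdom P \<Longrightarrow> objective P x = ereal (ffun P x + gval P x)"
  by (simp add: objective_def gtotal_in)

lemma objective_notin: "x \<notin> gdom P \<Longrightarrow> objective P x = \<infinity>"
  by (simp add: objective_def gtotal_notin)

lemma feasible_xstar: "Amat P *v xstar = cvec P"
  using primal_opt by (simp add: is_arg_min_def)

lemma opt_value_objective: "opt_value P = objective P xstar"
proof (rule antisym)
  show "opt_value P \<le> objective P xstar"
    unfolding opt_value_def using feasible_xstar by (intro INF_lower) simp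
  show "objective P xstar \<le> opt_value P"
    unfolding opt_value_def using primal_opt
    by (intro INF_greatest) (auto simp: is_arg_min_linorder)
qed

lemma dual_lower: "opt_value P \<le> objective P x + ereal ((Amat P *v x) \<bullet> ystar) - ereal (cvec P \<bullet> ystar)"
  unfolding strong_duality[symmetric] dual_objective_def by (rule INF_lower) simp

text \<open>
  Properness of \<open>g\<close> bounds the dual objective from above by a finite number; were the optimal
  value infinite, strong duality would be violated.
\<close>

lemma xstar_gdom: "xstar \<in> gdom P"
proof (rule ccontr)
  assume "xstar \<notin> gdom P"
  then have "opt_value P = \<infinity>" by (simp add: opt_value_objective objective_notin)
  moreover obtain x where "gtotal P x \<noteq> \<infinity>"
    using g_pcc by (auto simp: proper_closed_convex_def)
  then have "x \<in> gdom P" using gtotal_notin by blast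
  ultimately show False using dual_lower[of x] by (simp add: objective_in)
qed

lemma opt_value_Fstar: "opt_value P = ereal Fstar"
  by (simp add: opt_value_objective objective_in xstar_gdom Fstar_def)

text \<open>
  This is where strong duality enters: the Lagrangian at the dual solution has the primal optimal
  value as its infimum.  It turns every bound on the residual into a lower bound on the objective.
\<close>

lemma lagrangian_ge_Fstar:
  assumes "x \<in> gdom P"
  shows "Fstar \<le> ffun P x + gval P x + (Amat P *v x - cvec P) \<bullet> ystar"
  using dual_lower[of x] by (simp add: opt_value_Fstar objective_in[OF assms] inner_diff_left)

lemma gval_convex:
  assumes "x \<in> gdom P" "y \<in> gdom P" "gval P x \<le> r" "gval P y \<le> s" "0 \<le> t" "t \<le> 1"
  shows "(1 - t) *\<^sub>R x + t *\<^sub>R y \<in> gdom P"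
    and "gval P ((1 - t) *\<^sub>R x + t *\<^sub>R y) \<le> (1 - t) * r + t * s"
proof -
  have "convex (ext_epigraph (gtotal P))" using g_pcc by (simp add: proper_closed_convex_def)
  moreover have "(x, r) \<in> ext_epigraph (gtotal P)" "(y, s) \<in> ext_epigraph (gtotal P)"
    using assms by (auto simp: ext_epigraph_def gtotal_le_iff)
  ultimately have "(1 - t) *\<^sub>R (x, r) + t *\<^sub>R (y, s) \<in> ext_epigraph (gtotal P)"
    using assms(5,6) by (intro convexD) auto
  then show "(1 - t) *\<^sub>R x + t *\<^sub>R y \<in> gdom P"
    and "gval P ((1 - t) *\<^sub>R x + t *\<^sub>R y) \<le> (1 - t) * r + t * s"
    by (auto simp: ext_epigraph_def gtotal_le_iff)
qed

lemma update_in_gdom: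
  assumes "x \<in> gdom P" "z \<in> block_space P i"
  shows "block_update P i x z \<in> gdom P \<longleftrightarrow> z \<in> block_dom P i"
  using assms by (auto simp: gdom_def block_proj_update split: if_splits)

text \<open>
  Convexity of the total \<open>g\<close> passes to each block: vary one block of the optimal point, where all the
  other terms are finite constants.
\<close>

lemma gblock_convex:
  assumes z: "z \<in> block_dom P i" and u: "u \<in> block_dom P i" and t: "0 \<le> t" "t \<le> 1"
  shows "(1 - t) *\<^sub>R z + t *\<^sub>R u \<in> block_dom P i"
    and "gblock P i ((1 - t) *\<^sub>R z + t *\<^sub>R u) \<le> (1 - t) * gblock P i z + t * gblock P i u"
proof -
  let ?U = "block_update P i xstar"
  have zs: "z \<in> block_space P i" and us: "u \<in> block_space P i"
    using z u by (auto simp: block_dom_def)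
  then have ws: "(1 - t) *\<^sub>R z + t *\<^sub>R u \<in> block_space P i"
    by (intro subspace_add subspace_scale subspace_block_space)
  have eq: "(1 - t) *\<^sub>R ?U z + t *\<^sub>R ?U u = ?U ((1 - t) *\<^sub>R z + t *\<^sub>R u)"
    by (simp add: block_update_def algebra_simps)
  have zu: "?U z \<in> gdom P" "?U u \<in> gdom P"
    using z u by (simp_all add: update_in_gdom xstar_gdom zs us)
  note c = gval_convex[OF zu order_refl order_refl t, unfolded eq]
  from c(1) show "(1 - t) *\<^sub>R z + t *\<^sub>R u \<in> block_dom P i"
    by (simp add: update_in_gdom xstar_gdom ws)
  from c(2) show "gblock P i ((1 - t) *\<^sub>R z + t *\<^sub>R u) \<le> (1 - t) * gblock P i z + t * gblock P i u"
    unfolding gval_update[OF zs] gval_update[OF us] gval_update[OF ws] by (simp add: algebra_simps)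
qed

text \<open>
  The optimal point minimises the Lagrangian \<open>f + g + \<langle>A \<cdot> - c, y\<^sup>*\<rangle>\<close>, so its directional derivative along
  any segment that moves a single block is nonnegative.  The resulting affine minorant of the block
  term guarantees that the proximal subproblems have solutions.
\<close>

lemma gblock_subgradient:
  assumes z: "z \<in> block_dom P i"
  shows "gblock P i (block_proj P i xstar)
      - (gradient (ffun P) xstar + transpose (Amat P) *v ystar) \<bullet> (z - block_proj P i xstar)
    \<le> gblock P i z"
proof -
  define d where "d = z - block_proj P i xstar"
  define x where "x t = block_update P i xstar ((1 - t) *\<^sub>R block_proj P i xstar + t *\<^sub>R z)" for t
  let ?x0 = "block_proj P i xstar"
  have x0: "?x0 \<in> block_dom P i" using xstar_gdom by (simp add: gdom_def)
  have x: "x t = xstar + t *\<^sub>R d" for t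
    by (simp add: x_def block_update_def d_def algebra_simps)
  let ?a = "gblock P i z - gblock P i ?x0 + (Amat P *v d) \<bullet> ystar"
  have quot: "- ?a \<le> (ffun P (xstar + t *\<^sub>R d) - ffun P xstar) / t" if t: "0 < t" "t < 1" for t
  proof -
    let ?w = "(1 - t) *\<^sub>R ?x0 + t *\<^sub>R z"
    have w: "?w \<in> block_dom P i" "gblock P i ?w \<le> (1 - t) * gblock P i ?x0 + t * gblock P i z"
      using gblock_convex[OF x0 z, of t] t by auto
    then have ws: "?w \<in> block_space P i" by (simp add: block_dom_def)
    have "x t \<in> gdom P" using w by (simp add: x_def update_in_gdom xstar_gdom ws)
    from lagrangian_ge_Fstar[OF this]
    have "ffun P xstar + gval P xstar \<le> ffun P (xstar + t *\<^sub>R d) + gval P (x t) + t * ((Amat P *v d) \<bullet> ystar)"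
      by (simp add: Fstar_def x matrix_vector_right_distrib matrix_vector_mult_scaleR feasible_xstar)
    also have "gval P (x t) = gval P xstar + (gblock P i ?w - gblock P i ?x0)"
      by (simp add: x_def gval_update ws)
    finally have "- t * ?a \<le> ffun P (xstar + t *\<^sub>R d) - ffun P xstar"
      using w(2) by (simp add: algebra_simps)
    then show ?thesis using t by (simp add: field_simps)
  qed
  have "((\<lambda>t. ffun P (xstar + t *\<^sub>R d)) has_real_derivative gradient (ffun P) xstar \<bullet> d) (at 0 within {0<..})"
    using gradient_line_derivative[OF f_diff, of xstar d 0] by simp
  then have lim: "((\<lambda>t. (ffun P (xstar + t *\<^sub>R d) - ffun P xstar) / t) \<longlongrightarrow> gradient (ffun P) xstar \<bullet> d) (at_right 0)"
    by (simp add: has_field_derivative_iff)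
  have "- ?a \<le> gradient (ffun P) xstar \<bullet> d"
  proof (rule tendsto_lowerbound[OF lim])
    show "\<forall>\<^sub>F t in at_right 0. - ?a \<le> (ffun P (xstar + t *\<^sub>R d) - ffun P xstar) / t"
      using eventually_at_right_real[OF zero_less_one]
      by (rule eventually_mono) (use quot in auto)
  qed simp
  moreover have "(transpose (Amat P) *v ystar) \<bullet> d = (Amat P *v d) \<bullet> ystar"
    by (metis dot_lmul_matrix inner_commute transpose_matrix_vector)
  ultimately show ?thesis by (simp add: d_def inner_add_left)
qed

section \<open>The proximal step\<close>

text \<open>
  Up to an additive constant, this is the objective of a block subproblem with linear term \<open>v\<close>, prox
  parameter \<open>\<rho>\<close> and prox centre \<open>c\<close>.
\<close>

definition prox_obj :: "'n \<Rightarrow> real^'p \<Rightarrow> real \<Rightarrow> real^'p \<Rightarrow> real^'p \<Rightarrow> real" where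
  "prox_obj i v \<rho> c z = v \<bullet> z + gblock P i z + \<rho> / 2 * (block_norm P (z - c))\<^sup>2"

lemma block_proj_xstar: "block_proj P i xstar \<in> block_dom P i"
  using xstar_gdom by (simp add: gdom_def)

lemma closed_block_epigraph: "closed {(z, r). z \<in> block_dom P i \<and> gblock P i z \<le> r}"
proof -
  let ?C = "gval P xstar - gblock P i (block_proj P i xstar)"
  let ?h = "\<lambda>p. (block_update P i xstar (fst p), snd p + ?C)"
  have "closed (?h -` ext_epigraph (gtotal P))"
    using g_pcc unfolding block_update_def
    by (intro closed_vimage continuous_intros) (auto simp: proper_closed_convex_def)
  moreover have "closed (block_space P i \<times> (UNIV :: real set))"
    by (intro closed_Times closed_block_space closed_UNIV)
  moreover have "{(z, r). z \<in> block_dom P i \<and> gblock P i z \<le> r}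
      = ?h -` ext_epigraph (gtotal P) \<inter> (block_space P i \<times> UNIV)"
  proof -
    have "(z \<in> block_dom P i \<and> gblock P i z \<le> r) \<longleftrightarrow>
      z \<in> block_space P i \<and> (block_update P i xstar z, r + ?C) \<in> ext_epigraph (gtotal P)" for z r
    proof (cases "z \<in> block_space P i")
      case True
      then show ?thesis
        by (auto simp: ext_epigraph_def gtotal_le_iff update_in_gdom xstar_gdom gval_update)
    qed (simp add: block_dom_def)
    then show ?thesis by (auto simp del: add_diff_eq)
  qed
  ultimately show ?thesis by (simp add: closed_Int)
qed

lemma prox_sublevel_bounded:
  assumes \<rho>: "0 < \<rho>"
  obtains R where "\<And>z. z \<in> block_dom P i \<Longrightarrow> prox_obj i v \<rho> c z \<le> M \<Longrightarrow> norm (z - c) \<le> R"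
proof -
  obtain l where l: "0 < l" "\<And>x. l * (norm x)\<^sup>2 \<le> (Hmat P *v x) \<bullet> x"
    using spd_coercive[OF H_pos] by blast
  define w where "w = gradient (ffun P) xstar + transpose (Amat P) *v ystar"
  define b where "b = M - v \<bullet> c + w \<bullet> (c - block_proj P i xstar) - gblock P i (block_proj P i xstar)"
  define a where "a = \<rho> / 2 * l"
  have a: "0 < a" using \<rho> l by (simp add: a_def)
  show ?thesis
  proof
    fix z assume z: "z \<in> block_dom P i" and M: "prox_obj i v \<rho> c z \<le> M"
    let ?s = "norm (z - c)"
    have "a * ?s\<^sup>2 \<le> \<rho> / 2 * (block_norm P (z - c))\<^sup>2"
      using l(2)[of "z - c"] \<rho> by (simp add: a_def block_norm_sq mult_left_mono)
    moreover have "gblock P i (block_proj P i xstar) - w \<bullet> (z - block_proj P i xstar) \<le> gblock P i z"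
      unfolding w_def by (rule gblock_subgradient[OF z])
    moreover have "(w - v) \<bullet> (z - c) \<le> norm (w - v) * ?s" by (rule norm_cauchy_schwarz)
    ultimately have q: "a * ?s\<^sup>2 \<le> b + norm (w - v) * ?s"
      using M by (simp add: prox_obj_def b_def inner_diff_left inner_diff_right)
    \<comment> \<open>For \<open>?s \<ge> 1\<close> the constant \<open>b\<close> may be multiplied by \<open>?s\<close>, and one factor \<open>?s\<close> cancels.\<close>
    show "?s \<le> max 1 ((\<bar>b\<bar> + norm (w - v)) / a)"
    proof (cases "?s \<le> 1")
      case False
      then have "b \<le> \<bar>b\<bar> * ?s"
        using mult_left_mono[of 1 ?s "\<bar>b\<bar>"] by simp
      with q have "(a * ?s) * ?s \<le> (\<bar>b\<bar> + norm (w - v)) * ?s"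
        by (simp add: power2_eq_square algebra_simps)
      then have "a * ?s \<le> \<bar>b\<bar> + norm (w - v)" by (rule mult_right_le_imp_le) (use False in linarith)
      then show ?thesis using a by (simp add: field_simps le_max_iff_disj)
    qed simp
  qed
qed

text \<open>
  The block term is only lower semicontinuous, so the minimum is taken over a sublevel set of its
  epigraph: the function \<open>(z, r) \<mapsto> \<langle>v, z\<rangle> + r + \<rho> \<parallel>z - c\<parallel>\<^sup>2 / 2\<close> is continuous there, and the set is compact
  by the affine minorant and the strong convexity of the quadratic term.
\<close>

lemma prox_exists:
  assumes \<rho>: "0 < \<rho>"
  obtains z where "z \<in> block_dom P i" "\<And>u. u \<in> block_dom P i \<Longrightarrow> prox_obj i v \<rho> c z \<le> prox_obj i v \<rho> c u"
proof -
  let ?x0 = "block_proj P i xstar"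
  define M where "M = prox_obj i v \<rho> c ?x0"
  define \<Phi> where "\<Phi> = (\<lambda>p. v \<bullet> fst p + snd p + \<rho> / 2 * (block_norm P (fst p - c))\<^sup>2)"
  define K where "K = {(z, r). z \<in> block_dom P i \<and> gblock P i z \<le> r} \<inter> {p. \<Phi> p \<le> M}"
  have cont: "continuous_on S \<Phi>" for S
    unfolding \<Phi>_def block_norm_sq
    by (intro continuous_intros bounded_linear.continuous_on[OF matrix_vector_mul_bounded_linear])
  have closed: "closed K" unfolding K_def
    by (intro closed_Int closed_block_epigraph closed_Collect_le cont continuous_on_const)
  obtain R where R: "\<And>z. z \<in> block_dom P i \<Longrightarrow> prox_obj i v \<rho> c z \<le> M \<Longrightarrow> norm (z - c) \<le> R"
    using prox_sublevel_bounded[OF \<rho>] by blast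
  define w where "w = gradient (ffun P) xstar + transpose (Amat P) *v ystar"
  have "K \<subseteq> cball c R \<times> {gblock P i ?x0 - norm w * (R + norm (c - ?x0)) .. M + norm v * (R + norm c)}"
  proof safe
    fix z r assume "(z, r) \<in> K"
    then have z: "z \<in> block_dom P i" and r: "gblock P i z \<le> r" and le: "\<Phi> (z, r) \<le> M"
      by (auto simp: K_def)
    have "prox_obj i v \<rho> c z \<le> M" using r le by (simp add: prox_obj_def \<Phi>_def)
    then have nz: "norm (z - c) \<le> R" by (rule R[OF z])
    then show "z \<in> cball c R" by (simp add: dist_norm norm_minus_commute)
    have "norm (z - ?x0) \<le> R + norm (c - ?x0)"
      using nz norm_triangle_ineq[of "z - c" "c - ?x0"] by simp
    then have "w \<bullet> (z - ?x0) \<le> norm w * (R + norm (c - ?x0))"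
      by (meson mult_left_mono norm_cauchy_schwarz norm_ge_zero order_trans)
    moreover have "norm z \<le> R + norm c" using nz norm_triangle_ineq[of "z - c" c] by simp
    then have "- (v \<bullet> z) \<le> norm v * (R + norm c)"
      using norm_cauchy_schwarz[of "- v" z] mult_left_mono[of "norm z" "R + norm c" "norm v"] by simp
    moreover have "0 \<le> \<rho> / 2 * (block_norm P (z - c))\<^sup>2" using \<rho> by simp
    ultimately show "r \<in> {gblock P i ?x0 - norm w * (R + norm (c - ?x0)) .. M + norm v * (R + norm c)}"
      using gblock_subgradient[OF z, folded w_def] r le by (simp add: \<Phi>_def)
  qed
  then have "bounded K" by (rule bounded_subset[rotated]) (intro bounded_Times bounded_cball bounded_closed_interval)
  with closed have "compact K" by (simp add: compact_eq_bounded_closed)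
  moreover have "(?x0, gblock P i ?x0) \<in> K"
    using block_proj_xstar by (simp add: K_def M_def \<Phi>_def prox_obj_def)
  ultimately obtain p where p: "p \<in> K" "\<And>p'. p' \<in> K \<Longrightarrow> \<Phi> p \<le> \<Phi> p'"
    using continuous_attains_inf[OF _ _ cont, of K] by blast
  obtain z r where zr: "p = (z, r)" by force
  have z: "z \<in> block_dom P i" "gblock P i z \<le> r" "\<Phi> p \<le> M" using p(1) by (auto simp: K_def zr)
  have zle: "prox_obj i v \<rho> c z \<le> \<Phi> p" using z by (simp add: prox_obj_def \<Phi>_def zr)
  show ?thesis
  proof
    fix u assume u: "u \<in> block_dom P i"
    show "prox_obj i v \<rho> c z \<le> prox_obj i v \<rho> c u"
    proof (cases "prox_obj i v \<rho> c u \<le> M")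
      case True
      then have "(u, gblock P i u) \<in> K" using u by (simp add: K_def \<Phi>_def prox_obj_def)
      from p(2)[OF this] zle show ?thesis by (simp add: \<Phi>_def prox_obj_def)
    next
      case False
      then show ?thesis using zle z by simp
    qed
  qed (rule z)
qed

text \<open>
  Compare the minimiser with the points \<open>(1 - t) z + t u\<close> and let \<open>t \<rightarrow> 0\<close>; the quadratic term loses
  \<open>t (1 - t) \<rho> \<parallel>u - z\<parallel>\<^sup>2 / 2\<close> along the segment.
\<close>

lemma prox_three_point:
  assumes z: "z \<in> block_dom P i" and u: "u \<in> block_dom P i"
    and min: "\<And>u. u \<in> block_dom P i \<Longrightarrow> prox_obj i v \<rho> c z \<le> prox_obj i v \<rho> c u"
    and \<rho>: "0 \<le> \<rho>"
  shows "prox_obj i v \<rho> c z + \<rho> / 2 * (block_norm P (u - z))\<^sup>2 \<le> prox_obj i v \<rho> c u"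
proof -
  let ?N = "\<rho> / 2 * (block_norm P (u - z))\<^sup>2"
  have *: "prox_obj i v \<rho> c z + (1 - t) * ?N \<le> prox_obj i v \<rho> c u" if t: "0 < t" "t < 1" for t
  proof -
    let ?w = "(1 - t) *\<^sub>R z + t *\<^sub>R u"
    have g: "?w \<in> block_dom P i" "gblock P i ?w \<le> (1 - t) * gblock P i z + t * gblock P i u"
      using gblock_convex[OF z u, of t] t by auto
    have "(block_norm P (?w - c))\<^sup>2 = (block_norm P ((1 - t) *\<^sub>R (z - c) + t *\<^sub>R (u - c)))\<^sup>2"
      by (simp add: algebra_simps)
    also have "\<dots> = (1 - t) * (block_norm P (z - c))\<^sup>2 + t * (block_norm P (u - c))\<^sup>2
        - t * (1 - t) * (block_norm P (z - u))\<^sup>2"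
      by (subst block_norm_convex_combination) simp
    also have "block_norm P (z - u) = block_norm P (u - z)"
      using block_norm_scaleR[of "-1" "u - z"] by simp
    finally have n0: "(block_norm P (?w - c))\<^sup>2 = (1 - t) * (block_norm P (z - c))\<^sup>2
        + t * (block_norm P (u - c))\<^sup>2 - t * (1 - t) * (block_norm P (u - z))\<^sup>2" .
    have n: "\<rho> / 2 * (block_norm P (?w - c))\<^sup>2 = (1 - t) * (\<rho> / 2 * (block_norm P (z - c))\<^sup>2)
        + t * (\<rho> / 2 * (block_norm P (u - c))\<^sup>2) - t * (1 - t) * ?N"
      unfolding n0 by (simp add: field_simps)
    have "prox_obj i v \<rho> c z \<le> prox_obj i v \<rho> c ?w" by (rule min[OF g(1)])
    also have "\<dots> \<le> (1 - t) * prox_obj i v \<rho> c z + t * prox_obj i v \<rho> c u - t * (1 - t) * ?N"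
      using g(2) unfolding prox_obj_def n by (simp add: inner_add_right algebra_simps)
    finally have "t * (prox_obj i v \<rho> c z + (1 - t) * ?N) \<le> t * prox_obj i v \<rho> c u"
      by (simp add: algebra_simps)
    then show ?thesis using t by simp
  qed
  have lim: "((\<lambda>t. prox_obj i v \<rho> c z + (1 - t) * ?N) \<longlongrightarrow> prox_obj i v \<rho> c z + (1 - 0) * ?N) (at_right 0)"
    by (intro tendsto_intros)
  have "prox_obj i v \<rho> c z + (1 - 0) * ?N \<le> prox_obj i v \<rho> c u"
  proof (rule tendsto_upperbound[OF lim])
    show "\<forall>\<^sub>F t in at_right 0. prox_obj i v \<rho> c z + (1 - t) * ?N \<le> prox_obj i v \<rho> c u"
      using eventually_at_right_real[OF zero_less_one] by (rule eventually_mono) (use * in auto)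
  qed simp
  then show ?thesis by simp
qed

lemma norm_A_block:
  "d \<in> block_space P i \<Longrightarrow> norm (Amat P *v d) \<le> block_spectral_norm P i * block_norm P d"
  using norm_compat by (auto simp: spectral_norm_compatible_def)

lemma step_const_nonneg: "0 < \<beta> \<Longrightarrow> 0 \<le> step_const P \<beta> i"
  using Lhat_nonneg[of i] by (simp add: step_const_def)

text \<open>
  With a vanishing Lipschitz constant, \<open>f\<close> is affine along the block through the optimal point.  It
  lies above its tangent plane at \<open>x\<close> along this whole line, which forces the two slopes to agree.
\<close>

lemma affine_block_gradient:
  assumes L: "Lhat P i = 0" and d: "d \<in> block_space P i"
  shows "gradient (ffun P) x \<bullet> d = gradient (ffun P) xstar \<bullet> d"
proof (rule ccontr)
  let ?g = "gradient (ffun P)"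
  let ?e = "?g x \<bullet> d - ?g xstar \<bullet> d"
  let ?K = "ffun P xstar - ffun P x - ?g x \<bullet> (xstar - x)"
  assume "?g x \<bullet> d \<noteq> ?g xstar \<bullet> d"
  then have e: "?e \<noteq> 0" by simp
  have "t * ?e \<le> ?K" for t
  proof -
    have "ffun P (xstar + t *\<^sub>R d) \<le> ffun P xstar + t * (?g xstar \<bullet> d)"
      using f_block_descent[OF subspace_scale[OF subspace_block_space d], of xstar t] by (simp add: L)
    moreover have "ffun P x + ?g x \<bullet> (xstar + t *\<^sub>R d - x) \<le> ffun P (xstar + t *\<^sub>R d)"
      by (rule f_tangent)
    ultimately show ?thesis by (simp add: algebra_simps inner_diff_right inner_add_right)
  qed
  \<comment> \<open>A linear function of \<open>t\<close> with nonzero slope is not bounded above.\<close>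
  from this[of "(?K + 1) / ?e"] e show False by simp
qed

text \<open>
  A step constant can be 0 when \<open>\<alpha> = 0\<close>.  Then the subproblem has no quadratic term, and
  coercivity is lost.  But in that case the block enters neither the constraint nor the curvature of
  \<open>f\<close>, so the subproblem is the same at every point, and the optimal point solves it.
\<close>

lemma prox_minimizer_degenerate:
  assumes \<beta>: "0 < \<beta>" and B: "step_const P \<beta> i = 0" and u: "u \<in> block_dom P i"
  shows "prox_obj i (gradient (ffun P) x + transpose (Amat P) *v y) 0 c (block_proj P i xstar)
    \<le> prox_obj i (gradient (ffun P) x + transpose (Amat P) *v y) 0 c u"
proof -
  have "Lhat P i = 0" "(block_spectral_norm P i)\<^sup>2 / \<beta> = 0"
    using B Lhat_nonneg[of i] \<beta> divide_nonneg_pos[of "(block_spectral_norm P i)\<^sup>2" \<beta>]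
    by (auto simp: step_const_def add_nonneg_eq_0_iff)
  then have L: "Lhat P i = 0" and S: "block_spectral_norm P i = 0" using \<beta> by auto
  let ?d = "u - block_proj P i xstar"
  have d: "?d \<in> block_space P i"
    using u by (auto simp: block_dom_def intro!: subspace_diff subspace_block_space)
  have "Amat P *v ?d = 0" using norm_A_block[OF d] S by simp
  then have At: "(transpose (Amat P) *v y) \<bullet> ?d = 0" for y
    by (metis dot_lmul_matrix inner_commute inner_zero_left transpose_matrix_vector)
  have "gblock P i (block_proj P i xstar) - gradient (ffun P) x \<bullet> ?d \<le> gblock P i u"
    using gblock_subgradient[OF u] At[of ystar] affine_block_gradient[OF L d, of x]
    by (simp add: inner_add_left)
  then show ?thesis
    using At[of y] by (simp add: prox_obj_def inner_add_left inner_diff_right)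
qed

text \<open>
  The minimum is attained in every case, so \<open>arg_min\<close> picks a true minimiser of the subproblem (not
  necessarily the only one in the degenerate case).
\<close>

lemma prox_step:
  fixes k :: nat and i :: 'n and xh xt :: "real^'p"
  defines "z \<equiv> arg_min (block_subproblem P k i xh xt) (\<lambda>z. z \<in> block_space P i)"
    and "v \<equiv> gradient (ffun P) xh + transpose (Amat P) *v ystar_of P k xh"
    and "\<rho> \<equiv> tau P k * Bconst P k i / tau0 P"
  assumes pos: "0 < beta P (Suc k)" "0 < tau P k" "0 < tau0 P"
  shows "z \<in> block_dom P i"
    and "u \<in> block_dom P i \<Longrightarrow> prox_obj i v \<rho> (block_proj P i xt) z \<le> prox_obj i v \<rho> (block_proj P i xt) u"
proof -
  let ?Q = "prox_obj i v \<rho> (block_proj P i xt)" and ?S = "block_subproblem P k i xh xt"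
  have B: "0 \<le> Bconst P k i" unfolding Bconst_def by (rule step_const_nonneg[OF pos(1)])
  have lin: "(block_proj P i (gradient (ffun P) xh) + transpose (block_matrix P i) *v ystar_of P k xh)
      \<bullet> (z - block_proj P i xh) = v \<bullet> z - v \<bullet> block_proj P i xh" if "z \<in> block_space P i" for z
    unfolding transpose_block_matrix v_def using that
    by (simp add: inner_add_left inner_block_proj block_proj_diff
        block_proj_id inner_diff_right)
  have S_in: "?S z = ereal (?Q z - v \<bullet> block_proj P i xh)" if z: "z \<in> block_dom P i" for z
  proof -
    have zs: "z \<in> block_space P i" using z by (simp add: block_dom_def)
    have "gfun P i z = ereal (gblock P i z)"
      using z g_not_MInf[OF zs] by (auto simp: block_dom_def gblock_def ereal_real)
    then show ?thesis
      unfolding block_subproblem_def lin[OF zs] by (simp add: prox_obj_def \<rho>_def)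
  qed
  have S_out: "?S z = \<infinity>" if "z \<in> block_space P i" "z \<notin> block_dom P i" for z
    using that by (simp add: block_subproblem_def block_dom_def)
  obtain z0 where z0: "z0 \<in> block_dom P i" "\<And>u. u \<in> block_dom P i \<Longrightarrow> ?Q z0 \<le> ?Q u"
  proof (cases "Bconst P k i = 0")
    case True
    then have "\<rho> = 0" by (simp add: \<rho>_def)
    with True show ?thesis
      using that[OF block_proj_xstar] prox_minimizer_degenerate[OF pos(1)]
      unfolding v_def Bconst_def by blast
  next
    case False
    then have "0 < \<rho>" using B pos by (simp add: \<rho>_def)
    from prox_exists[OF this] that show ?thesis by blast
  qed
  have z0s: "z0 \<in> block_space P i" using z0 by (simp add: block_dom_def)
  have "is_arg_min ?S (\<lambda>z. z \<in> block_space P i) z0"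
    unfolding is_arg_min_linorder
  proof (intro conjI allI impI)
    fix u assume u: "u \<in> block_space P i"
    show "?S z0 \<le> ?S u"
      using z0 S_out[OF u] by (cases "u \<in> block_dom P i") (auto simp: S_in)
  qed (rule z0s)
  then have "is_arg_min ?S (\<lambda>z. z \<in> block_space P i) z"
    unfolding z_def arg_min_def by (rule someI)
  then have zs: "z \<in> block_space P i" and zmin: "\<And>u. u \<in> block_space P i \<Longrightarrow> ?S z \<le> ?S u"
    by (auto simp: is_arg_min_linorder)
  show z: "z \<in> block_dom P i"
    using zmin[OF z0s] S_in[OF z0(1)] S_out[OF zs] by (cases "z \<in> block_dom P i") auto
  show "?Q z \<le> ?Q u" if u: "u \<in> block_dom P i"
    using zmin[of u] u S_in[OF z] S_in[OF u] by (simp add: block_dom_def)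
qed

end

section \<open>Smoothed penalty and parameters\<close>

text \<open>
  Read at fixed \<open>r\<close>, this evaluates the maximum over \<open>y\<close> in the definition of the smoothed
  indicator: the last term vanishes exactly at \<open>y = y0 + r / \<beta>\<close>.
\<close>

lemma complete_square:
  fixes r y y0 :: "'a::real_inner"
  assumes "0 < \<beta>"
  shows "r \<bullet> y - \<beta> / 2 * (norm (y - y0))\<^sup>2
    = r \<bullet> y0 + (norm r)\<^sup>2 / (2 * \<beta>) - (norm (r - \<beta> *\<^sub>R (y - y0)))\<^sup>2 / (2 * \<beta>)"
proof -
  define w where "w = y - y0"
  have y: "y = y0 + w" by (simp add: w_def)
  have n: "(norm (r - \<beta> *\<^sub>R w))\<^sup>2 = (norm r)\<^sup>2 - 2 * \<beta> * (r \<bullet> w) + \<beta>\<^sup>2 * (norm w)\<^sup>2"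
    unfolding power2_norm_eq_inner
    by (simp add: inner_diff_left inner_diff_right inner_commute[of w r] power2_eq_square algebra_simps)
  show ?thesis
    using assms unfolding w_def[symmetric] n unfolding y
    by (simp add: inner_add_right field_simps power2_eq_square)
qed

lemma h_smooth_eq:
  assumes "0 < \<beta>"
  shows "h_smooth P \<beta> u = (u - cvec P) \<bullet> ydot P + (norm (u - cvec P))\<^sup>2 / (2 * \<beta>)"
  unfolding h_smooth_def
proof (rule cSup_eq_maximum)
  let ?r = "u - cvec P"
  have "?r - \<beta> *\<^sub>R (ydot P + (1 / \<beta>) *\<^sub>R ?r - ydot P) = 0" using assms by simp
  then have "?r \<bullet> (ydot P + (1 / \<beta>) *\<^sub>R ?r) - \<beta> / 2 * (norm (ydot P + (1 / \<beta>) *\<^sub>R ?r - ydot P))\<^sup>2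
      = ?r \<bullet> ydot P + (norm ?r)\<^sup>2 / (2 * \<beta>)"
    unfolding complete_square[OF assms] by simp
  then show "?r \<bullet> ydot P + (norm ?r)\<^sup>2 / (2 * \<beta>) \<in> range (\<lambda>y. ?r \<bullet> y - \<beta> / 2 * (norm (y - ydot P))\<^sup>2)"
    by (intro range_eqI) (rule sym)
next
  fix s assume "s \<in> range (\<lambda>y. (u - cvec P) \<bullet> y - \<beta> / 2 * (norm (y - ydot P))\<^sup>2)"
  then show "s \<le> (u - cvec P) \<bullet> ydot P + (norm (u - cvec P))\<^sup>2 / (2 * \<beta>)"
    using assms unfolding complete_square[OF assms] by auto
qed

lemma h_smooth_ge:
  assumes "0 < \<beta>"
  shows "(u - cvec P) \<bullet> y - \<beta> / 2 * (norm (y - ydot P))\<^sup>2 \<le> h_smooth P \<beta> u"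
  unfolding h_smooth_eq[OF assms] complete_square[OF assms] using assms by simp

definition penalty :: "('p::finite, 'n::finite, 'm::finite) cd_problem \<Rightarrow> real \<Rightarrow> real^'p \<Rightarrow> real" where
  "penalty P \<beta> x = h_smooth P \<beta> (Amat P *v x)"

text \<open>
  The point at which the supremum defining the smoothed indicator is attained, so that
  \<open>A\<^sup>T (dual_point)\<close> is the gradient of the penalty.
\<close>

definition dual_point :: "('p::finite, 'n::finite, 'm::finite) cd_problem \<Rightarrow> real \<Rightarrow> real^'p \<Rightarrow> real^'m" where
  "dual_point P \<beta> x = ydot P + (1 / \<beta>) *\<^sub>R (Amat P *v x - cvec P)"

lemma inner_transpose: "(transpose A *v y) \<bullet> d = y \<bullet> (A *v d)"
  for A :: "real^'n^'m"
  by (metis dot_lmul_matrix transpose_matrix_vector)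

lemma penalty_expansion:
  assumes "0 < \<beta>"
  shows "penalty P \<beta> (x + d) = penalty P \<beta> x + (transpose (Amat P) *v dual_point P \<beta> x) \<bullet> d
    + (norm (Amat P *v d))\<^sup>2 / (2 * \<beta>)"
proof -
  define r where "r = Amat P *v x - cvec P"
  define a where "a = Amat P *v d"
  have ra: "Amat P *v (x + d) - cvec P = r + a"
    by (simp add: matrix_vector_right_distrib r_def a_def)
  have "(norm (r + a))\<^sup>2 = (norm r)\<^sup>2 + 2 * (r \<bullet> a) + (norm a)\<^sup>2"
    unfolding power2_norm_eq_inner by (simp add: inner_add_left inner_add_right inner_commute[of a r])
  then show ?thesis
    unfolding penalty_def h_smooth_eq[OF assms] inner_transpose dual_point_def ra r_def[symmetric] a_def[symmetric]
    using assms by (simp add: inner_add_left inner_commute[of a] field_simps)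
qed

context cd_optimum
begin

lemma weight_sum_nonzero: "(\<Sum>j\<in>UNIV. weight P j) \<noteq> 0"
proof
  assume "(\<Sum>j\<in>UNIV. weight P j) = 0"
  then show False using q_pos[of undefined] by (simp add: qprob_def)
qed

lemma sum_qprob: "(\<Sum>i\<in>UNIV. qprob P i) = 1"
  using weight_sum_nonzero by (simp add: qprob_def flip: sum_divide_distrib)

lemma tau0_le: "tau0 P \<le> qprob P i"
  by (simp add: tau0_def)

lemma tau0_pos: "0 < tau0 P"
  using q_pos by (simp add: tau0_def)

lemma qprob_le_1: "qprob P i \<le> 1"
  using member_le_sum[of i UNIV "qprob P"] q_pos by (simp add: sum_qprob less_imp_le)

lemma tau0_le_1: "tau0 P \<le> 1"
  using tau0_le qprob_le_1 order_trans by blast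

lemma denom_pos: "0 < 1 + real k * tau0 P"
  using tau0_pos by (simp add: add_pos_nonneg)

lemma tau_eq: "tau P k = tau0 P / (1 + real k * tau0 P)"
proof (induction k)
  case (Suc k)
  define D where "D = 1 + real k * tau0 P"
  have D: "0 < D" using denom_pos by (simp add: D_def)
  have "1 + tau0 P / D = (D + tau0 P) / D" using D by (simp add: field_simps)
  then have "tau P (Suc k) = tau0 P / (D + tau0 P)"
    using D tau0_pos by (simp add: Suc D_def[symmetric])
  then show ?case by (simp add: D_def algebra_simps)
qed simp

lemma tau_pos: "0 < tau P k"
  using tau0_pos denom_pos by (simp add: tau_eq)

lemma tau_le_1: "tau P k \<le> 1"
  using tau0_pos tau0_le_1 denom_pos[of k] by (simp add: tau_eq divide_le_eq_1 add_increasing2)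

lemma one_minus_tau_Suc: "1 - tau P (Suc k) = tau P (Suc k) / tau P k"
proof -
  have "1 - t / (1 + t) = t / (1 + t) / t" if "0 < t" for t :: real
    using that by (simp add: diff_divide_eq_iff)
  from this[OF tau_pos] show ?thesis by simp
qed

lemma beta_Suc: "beta P (Suc k) = beta1 P * tau P k / tau0 P"
proof (induction k)
  case (Suc k)
  have "beta P (Suc (Suc k)) = tau P (Suc k) / tau P k * beta P (Suc k)"
    by (simp only: beta.simps one_minus_tau_Suc)
  then show ?case using Suc tau_pos[of k] by (simp del: beta.simps tau.simps)
qed (use tau0_pos in simp)

lemma beta_Suc_pos: "0 < beta P (Suc k)"
  unfolding beta_Suc using beta1_pos tau_pos tau0_pos by simp

lemma beta_pos: "0 < beta P k"
  using beta_Suc_pos beta1_pos tau0_pos by (cases k) (simp_all del: beta.simps(3))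

text \<open>
  For \<open>k \<ge> 1\<close> this is an equality by the definition of \<open>beta\<close>.  The initial value
  \<open>(1 + tau0) * beta1\<close> is smaller than \<open>beta1 / (1 - tau0)\<close>, so only the inequality survives at
  \<open>k = 0\<close>; the inequality is all that the descent estimate needs.
\<close>

lemma beta_decrease: "(1 - tau P k) * beta P k \<le> beta P (Suc k)"
proof (cases k)
  case 0
  have "(1 - tau0 P) * (1 + tau0 P) \<le> 1" by (simp add: algebra_simps)
  then have "((1 - tau0 P) * (1 + tau0 P)) * beta1 P \<le> 1 * beta1 P"
    using beta1_pos by (intro mult_right_mono) auto
  then show ?thesis using 0 by (simp add: mult.assoc)
qed (simp del: tau.simps)

lemma penalty_xstar: "0 < \<beta> \<Longrightarrow> penalty P \<beta> xstar = 0"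
  by (simp add: penalty_def h_smooth_eq feasible_xstar)

text \<open>
  The penalty is quadratic with curvature \<open>\<parallel>A d\<parallel>\<^sup>2 / \<beta>\<close>, which the compatibility of the norms bounds by
  the second summand of the step constant.
\<close>

lemma smoothed_block_descent:
  assumes \<beta>: "0 < \<beta>" and d: "d \<in> block_space P i"
  shows "ffun P (x + d) + penalty P \<beta> (x + d)
    \<le> ffun P x + penalty P \<beta> x + (gradient (ffun P) x + transpose (Amat P) *v dual_point P \<beta> x) \<bullet> d
      + step_const P \<beta> i / 2 * (block_norm P d)\<^sup>2"
proof -
  have "(norm (Amat P *v d))\<^sup>2 \<le> (block_spectral_norm P i * block_norm P d)\<^sup>2"
    by (intro power_mono norm_A_block[OF d]) simp
  then have "(norm (Amat P *v d))\<^sup>2 / (2 * \<beta>) \<le> (block_spectral_norm P i)\<^sup>2 / \<beta> / 2 * (block_norm P d)\<^sup>2"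
    using \<beta> by (simp add: power_mult_distrib field_simps)
  then show ?thesis
    using f_block_descent[OF d, of x] unfolding penalty_expansion[OF \<beta>]
    by (simp add: step_const_def inner_add_left algebra_simps add_divide_distrib)
qed

text \<open>
  The direction \<open>\<tau> (x\<^sup>* - xt)\<close> equals \<open>\<tau> (x\<^sup>* - xh) + (1 - \<tau>) (xb - xh)\<close>.  For \<open>f\<close> the tangent inequality
  is applied to both parts.  For the penalty the tangent inequality is an identity with the
  remainders \<open>\<parallel>A (x - xh)\<parallel>\<^sup>2 / (2 \<beta>)\<close>; with residuals \<open>r\<close> they add up to a square
  \<open>\<parallel>r xh - (1 - \<tau>) r xb\<parallel>\<^sup>2\<close> plus exactly what is needed to replace \<open>\<beta>\<close> by the larger smoothing
  parameter of the preceding step.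
\<close>

lemma extrapolation_bound:
  fixes k :: nat and xb xt :: "real^'p"
  defines "xh \<equiv> xhat_of P k xb xt" and "\<beta> \<equiv> beta P (Suc k)"
  shows "ffun P xh + penalty P \<beta> xh
      + tau P k * ((gradient (ffun P) xh + transpose (Amat P) *v dual_point P \<beta> xh) \<bullet> (xstar - xt))
    \<le> (1 - tau P k) * (ffun P xb + penalty P (beta P k) xb) + tau P k * ffun P xstar"
proof -
  define t where "t = tau P k"
  define g where "g = gradient (ffun P) xh"
  define a where "a = transpose (Amat P) *v dual_point P \<beta> xh"
  define r where "r x = Amat P *v x - cvec P" for x
  have t: "0 < t" "t \<le> 1" using tau_pos tau_le_1 by (auto simp: t_def)
  have \<beta>: "0 < \<beta>" and \<beta>k: "0 < beta P k" using beta_pos by (auto simp: \<beta>_def)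
  have dir: "t *\<^sub>R (xstar - xt) = t *\<^sub>R (xstar - xh) + (1 - t) *\<^sub>R (xb - xh)"
    by (simp add: xh_def xhat_of_def t_def algebra_simps)
  have f: "ffun P xh + t * (g \<bullet> (xstar - xt)) \<le> (1 - t) * ffun P xb + t * ffun P xstar"
  proof -
    have "t * (g \<bullet> (xstar - xt)) = t * (g \<bullet> (xstar - xh)) + (1 - t) * (g \<bullet> (xb - xh))"
      by (metis dir inner_add_right inner_scaleR_right)
    moreover have "t * (ffun P xh + g \<bullet> (xstar - xh)) \<le> t * ffun P xstar"
      "(1 - t) * (ffun P xh + g \<bullet> (xb - xh)) \<le> (1 - t) * ffun P xb"
      unfolding g_def using t by (intro mult_left_mono f_tangent; simp)+
    ultimately show ?thesis by (simp add: algebra_simps)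
  qed
  have pen: "penalty P \<beta> xh + a \<bullet> (x - xh) = penalty P \<beta> x - (norm (r x - r xh))\<^sup>2 / (2 * \<beta>)" for x
    using penalty_expansion[OF \<beta>, of P xh "x - xh"]
    by (simp add: a_def r_def matrix_vector_mult_diff_distrib)
  have p: "penalty P \<beta> xh + t * (a \<bullet> (xstar - xt)) \<le> (1 - t) * penalty P (beta P k) xb"
  proof -
    have rs: "r xstar = 0" by (simp add: r_def feasible_xstar)
    have "t * (a \<bullet> (xstar - xt)) = t * (a \<bullet> (xstar - xh)) + (1 - t) * (a \<bullet> (xb - xh))"
      by (metis dir inner_add_right inner_scaleR_right)
    then have "penalty P \<beta> xh + t * (a \<bullet> (xstar - xt))
        = t * (penalty P \<beta> xh + a \<bullet> (xstar - xh)) + (1 - t) * (penalty P \<beta> xh + a \<bullet> (xb - xh))"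
      by (simp add: algebra_simps)
    also have "\<dots> = (1 - t) * penalty P \<beta> xb
        - (t * (norm (r xh))\<^sup>2 + (1 - t) * (norm (r xb - r xh))\<^sup>2) / (2 * \<beta>)"
      unfolding pen using rs \<beta> by (simp add: penalty_xstar field_simps)
    also have "t * (norm (r xh))\<^sup>2 + (1 - t) * (norm (r xb - r xh))\<^sup>2
        = (1 - t) * (norm (r xb))\<^sup>2 - (1 - t)\<^sup>2 * (norm (r xb))\<^sup>2 + (norm (r xh - (1 - t) *\<^sub>R r xb))\<^sup>2"
      unfolding power2_norm_eq_inner
      by (simp add: inner_diff_left inner_diff_right inner_commute[of "r xb" "r xh"] algebra_simps power2_eq_square)
    finally have "penalty P \<beta> xh + t * (a \<bullet> (xstar - xt))
        \<le> (1 - t) * penalty P \<beta> xb - ((1 - t) * (norm (r xb))\<^sup>2 - (1 - t)\<^sup>2 * (norm (r xb))\<^sup>2) / (2 * \<beta>)"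
      using \<beta> zero_le_power2[of "norm (r xh - (1 - t) *\<^sub>R r xb)"]
      by (simp only: add_divide_distrib) simp
    also have "\<dots> = (1 - t) * (r xb \<bullet> ydot P + (1 - t) / \<beta> * (norm (r xb))\<^sup>2 / 2)"
      unfolding penalty_def h_smooth_eq[OF \<beta>] r_def[symmetric] using \<beta> by (simp add: field_simps power2_eq_square)
    also have "\<dots> \<le> (1 - t) * penalty P (beta P k) xb"
    proof -
      have "(1 - t) / \<beta> \<le> 1 / beta P k"
        using beta_decrease[of k] \<beta> \<beta>k by (simp add: field_simps t_def \<beta>_def)
      then have "(1 - t) / \<beta> * (norm (r xb))\<^sup>2 / 2 \<le> 1 / beta P k * (norm (r xb))\<^sup>2 / 2"
        by (intro divide_right_mono mult_right_mono) auto
      then show ?thesis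
        unfolding penalty_def h_smooth_eq[OF \<beta>k] r_def[symmetric] using t
        by (intro mult_left_mono) auto
    qed
    finally show ?thesis .
  qed
  from f p show ?thesis
    unfolding t_def[symmetric] g_def[symmetric] a_def[symmetric]
    by (simp add: inner_add_left algebra_simps)
qed

section \<open>Expected progress of one step\<close>

definition block_prox :: "nat \<Rightarrow> 'n \<Rightarrow> real^'p \<Rightarrow> real^'p \<Rightarrow> real^'p" where
  "block_prox k i xh xt = arg_min (block_subproblem P k i xh xt) (\<lambda>z. z \<in> block_space P i)"

lemma xtilde_step_update: "xtilde_step P k i xh xt = block_update P i xt (block_prox k i xh xt)"
  by (simp add: xtilde_step_def block_update_def block_prox_def)

lemma block_prox_dom: "block_prox k i xh xt \<in> block_dom P i"
  unfolding block_prox_def by (rule prox_step(1)[OF beta_Suc_pos tau_pos tau0_pos])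

text \<open>
  The weight carries \<open>1 / q\<^sub>i\<close>, so that the expected decrease of the potential, in which block \<open>i\<close> is drawn
  with probability \<open>q\<^sub>i\<close>, no longer depends on the sampling probabilities.
\<close>

definition dist_weight :: "nat \<Rightarrow> 'n \<Rightarrow> real" where
  "dist_weight k i = tau P k * Bconst P k i / (2 * tau0 P * qprob P i)"

definition potential :: "nat \<Rightarrow> real^'p \<Rightarrow> real" where
  "potential k x = (\<Sum>i\<in>UNIV. dist_weight k i * (block_norm P (block_proj P i xstar - block_proj P i x))\<^sup>2)"

lemma Bconst_nonneg: "0 \<le> Bconst P k i"
  unfolding Bconst_def by (rule step_const_nonneg[OF beta_Suc_pos])

text \<open>
  The step length \<open>\<tau> / \<tau>\<^sub>0\<close> is common to all blocks, although block \<open>i\<close> is drawn with probability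
  \<open>q\<^sub>i \<ge> \<tau>\<^sub>0\<close>.  Comparing the minimiser with the optimal point itself would leave the factor
  \<open>q\<^sub>i / \<tau>\<^sub>0\<close> in the expectation.  Comparing it with the convex combination
  \<open>u = (1 - \<theta>) c + \<theta> s\<close>, \<open>\<theta> = \<tau>\<^sub>0 / q\<^sub>i \<le> 1\<close>, gives the factor \<open>\<tau> / q\<^sub>i\<close>, which the
  probability \<open>q\<^sub>i\<close> cancels.  If \<open>\<tau>\<^sub>0 = 1\<close> then \<open>\<theta> = 1\<close> and \<open>c\<close> may lie outside the domain.
\<close>

lemma single_block_progress:
  fixes k :: nat and i :: 'n and xb xt :: "real^'p"
  defines "xh \<equiv> xhat_of P k xb xt" and "\<beta> \<equiv> beta P (Suc k)"
  defines "v \<equiv> gradient (ffun P) xh + transpose (Amat P) *v dual_point P \<beta> xh"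
    and "z \<equiv> block_prox k i xh xt" and "c \<equiv> block_proj P i xt" and "s \<equiv> block_proj P i xstar"
    and "xb' \<equiv> xh + (tau P k / tau0 P) *\<^sub>R (xtilde_step P k i xh xt - xt)"
  assumes dom: "tau0 P = 1 \<or> c \<in> block_dom P i"
  shows "ffun P xb' + penalty P \<beta> xb' + tau P k / tau0 P * (gblock P i z - gblock P i c)
    \<le> ffun P xh + penalty P \<beta> xh + tau P k / qprob P i * (v \<bullet> (s - c) + gblock P i s - gblock P i c)
      + tau P k * dist_weight k i * ((block_norm P (s - c))\<^sup>2 - (block_norm P (s - z))\<^sup>2)"
proof -
  define t where "t = tau P k"
  define t0 where "t0 = tau0 P"
  define q where "q = qprob P i"
  define B where "B = Bconst P k i"
  define \<rho> where "\<rho> = t * B / t0"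
  define \<theta> where "\<theta> = t0 / q"
  have pos: "0 < t" "0 < t0" "0 < q" "0 \<le> B"
    using tau_pos tau0_pos q_pos Bconst_nonneg by (auto simp: t_def t0_def q_def B_def)
  have \<theta>: "0 \<le> \<theta>" "\<theta> \<le> 1" using pos tau0_le[of i] by (auto simp: \<theta>_def t0_def q_def)
  have \<theta>1: "\<theta> = 1" if "tau0 P = 1"
    using that tau0_le[of i] qprob_le_1[of i] by (simp add: \<theta>_def t0_def q_def)
  have \<rho>: "0 \<le> \<rho>" using pos by (simp add: \<rho>_def)
  have z: "z \<in> block_dom P i" unfolding z_def by (rule block_prox_dom)
  have s: "s \<in> block_dom P i" unfolding s_def by (rule block_proj_xstar)
  have zcs: "z \<in> block_space P i" "c \<in> block_space P i" using z by (auto simp: block_dom_def c_def)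
  \<comment> \<open>A convex combination because \<open>\<tau>\<^sub>0\<close> is the smallest of the probabilities.\<close>
  define u where "u = (1 - \<theta>) *\<^sub>R c + \<theta> *\<^sub>R s"
  have u: "u \<in> block_dom P i" "gblock P i u \<le> (1 - \<theta>) * gblock P i c + \<theta> * gblock P i s"
  proof -
    have "u \<in> block_dom P i \<and> gblock P i u \<le> (1 - \<theta>) * gblock P i c + \<theta> * gblock P i s"
      using dom
    proof
      assume "tau0 P = 1"
      then show ?thesis using s \<theta>1 by (simp add: u_def)
    next
      assume "c \<in> block_dom P i"
      then show ?thesis using gblock_convex[OF _ s \<theta>] by (simp add: u_def)
    qed
    then show "u \<in> block_dom P i" "gblock P i u \<le> (1 - \<theta>) * gblock P i c + \<theta> * gblock P i s" by auto
  qed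
  define a where "a = (block_norm P (s - c))\<^sup>2"
  define b where "b = (block_norm P (s - z))\<^sup>2"
  define e where "e = (block_norm P (z - c))\<^sup>2"
  have ystar: "ystar_of P k xh = dual_point P \<beta> xh" by (simp add: ystar_of_def dual_point_def \<beta>_def)
  have "prox_obj i v \<rho> c z + \<rho> / 2 * (block_norm P (u - z))\<^sup>2 \<le> prox_obj i v \<rho> c u"
  proof (rule prox_three_point[OF z u(1) _ \<rho>])
    fix u' assume "u' \<in> block_dom P i"
    from prox_step(2)[OF beta_Suc_pos[of k] tau_pos[of k] tau0_pos this, where xh = xh and xt = xt]
    show "prox_obj i v \<rho> c z \<le> prox_obj i v \<rho> c u'"
      by (simp add: v_def ystar \<rho>_def t_def B_def t0_def c_def z_def block_prox_def)
  qed
  moreover have "(block_norm P (u - z))\<^sup>2 = (1 - \<theta>) * e + \<theta> * b - \<theta> * (1 - \<theta>) * a"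
  proof -
    have "u - z = (1 - \<theta>) *\<^sub>R (c - z) + \<theta> *\<^sub>R (s - z)" by (simp add: u_def algebra_simps)
    then have "(block_norm P (u - z))\<^sup>2 = (1 - \<theta>) * (block_norm P (c - z))\<^sup>2 + \<theta> * (block_norm P (s - z))\<^sup>2
      - \<theta> * (1 - \<theta>) * (block_norm P ((c - z) - (s - z)))\<^sup>2"
      by (simp only: block_norm_convex_combination)
    moreover have "block_norm P (c - z) = block_norm P (z - c)" "block_norm P ((c - z) - (s - z)) = block_norm P (s - c)"
      using block_norm_scaleR[of "-1" "z - c"] block_norm_scaleR[of "-1" "s - c"] by simp_all
    ultimately show ?thesis by (simp add: a_def b_def e_def)
  qed
  moreover have "(block_norm P (u - c))\<^sup>2 = \<theta>\<^sup>2 * a"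
  proof -
    have "u - c = \<theta> *\<^sub>R (s - c)" by (simp add: u_def algebra_simps)
    then show ?thesis by (simp add: block_norm_scaleR power_mult_distrib a_def)
  qed
  ultimately have "v \<bullet> z + gblock P i z + \<rho> / 2 * e + \<rho> / 2 * ((1 - \<theta>) * e + \<theta> * b - \<theta> * (1 - \<theta>) * a)
      \<le> v \<bullet> u + gblock P i u + \<rho> / 2 * (\<theta>\<^sup>2 * a)"
    by (simp add: prox_obj_def e_def)
  moreover have "0 \<le> \<rho> / 2 * ((1 - \<theta>) * e)" using \<rho> \<theta> by (simp add: e_def)
  moreover have "v \<bullet> u = v \<bullet> c + \<theta> * (v \<bullet> (s - c))"
    by (simp add: u_def inner_add_right inner_diff_right algebra_simps)
  moreover have "\<rho> / 2 * (\<theta>\<^sup>2 * a) - \<rho> / 2 * ((1 - \<theta>) * e + \<theta> * b - \<theta> * (1 - \<theta>) * a)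
      = \<theta> * (\<rho> / 2 * (a - b)) - \<rho> / 2 * ((1 - \<theta>) * e)"
    by (simp add: field_simps power2_eq_square)
  moreover have "\<theta> * (v \<bullet> (s - c) + gblock P i s - gblock P i c + \<rho> / 2 * (a - b))
      = \<theta> * (v \<bullet> (s - c)) + \<theta> * gblock P i s - \<theta> * gblock P i c + \<theta> * (\<rho> / 2 * (a - b))"
    "(1 - \<theta>) * gblock P i c = gblock P i c - \<theta> * gblock P i c"
    "v \<bullet> (z - c) = v \<bullet> z - v \<bullet> c"
    by (simp_all add: algebra_simps inner_diff_right)
  ultimately have "v \<bullet> (z - c) + gblock P i z - gblock P i c + \<rho> / 2 * e
      \<le> \<theta> * (v \<bullet> (s - c) + gblock P i s - gblock P i c + \<rho> / 2 * (a - b))"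
    using u(2) by linarith
  then have "t / t0 * (v \<bullet> (z - c) + gblock P i z - gblock P i c + \<rho> / 2 * e)
      \<le> t / t0 * (\<theta> * (v \<bullet> (s - c) + gblock P i s - gblock P i c + \<rho> / 2 * (a - b)))"
    using pos by (intro mult_left_mono) auto
  also have "\<dots> = t / q * (v \<bullet> (s - c) + gblock P i s - gblock P i c) + t * dist_weight k i * (a - b)"
    using pos by (simp add: \<theta>_def \<rho>_def dist_weight_def t_def[symmetric] B_def[symmetric]
        t0_def[symmetric] q_def[symmetric] field_simps)
  finally have gain: "t / t0 * (v \<bullet> (z - c) + gblock P i z - gblock P i c + \<rho> / 2 * e)
      \<le> t / q * (v \<bullet> (s - c) + gblock P i s - gblock P i c) + t * dist_weight k i * (a - b)" .
  have d: "(t / t0) *\<^sub>R (z - c) \<in> block_space P i"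
    using zcs by (intro subspace_scale subspace_diff subspace_block_space)
  have xb': "xb' = xh + (t / t0) *\<^sub>R (z - c)"
    by (simp add: xb'_def xtilde_step_update block_update_def z_def c_def t_def t0_def algebra_simps)
  have "ffun P xb' + penalty P \<beta> xb'
      \<le> ffun P xh + penalty P \<beta> xh + v \<bullet> ((t / t0) *\<^sub>R (z - c)) + B / 2 * (block_norm P ((t / t0) *\<^sub>R (z - c)))\<^sup>2"
    using smoothed_block_descent[OF beta_Suc_pos[of k] d, of xh]
    unfolding xb' v_def B_def Bconst_def \<beta>_def by simp
  also have "B / 2 * (block_norm P ((t / t0) *\<^sub>R (z - c)))\<^sup>2 = t / t0 * (\<rho> / 2 * e)"
    unfolding block_norm_scaleR e_def \<rho>_def using pos by (simp add: power2_eq_square field_simps)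
  finally have "ffun P xb' + penalty P \<beta> xb'
      \<le> ffun P xh + penalty P \<beta> xh + t / t0 * (v \<bullet> (z - c) + \<rho> / 2 * e)"
    by (simp add: distrib_left)
  with gain show ?thesis
    unfolding t_def[symmetric] t0_def[symmetric] q_def[symmetric] a_def[symmetric] b_def[symmetric]
    by (simp add: algebra_simps)
qed

lemma potential_step:
  "potential k (xtilde_step P k i xh xt) = potential k xt
    - dist_weight k i * ((block_norm P (block_proj P i xstar - block_proj P i xt))\<^sup>2
        - (block_norm P (block_proj P i xstar - block_prox k i xh xt))\<^sup>2)"
proof -
  have "block_prox k i xh xt \<in> block_space P i" using block_prox_dom by (simp add: block_dom_def)
  from sum_block_update[OF this, of "\<lambda>j w. dist_weight k j * (block_norm P (block_proj P j xstar - w))\<^sup>2" xt]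
  show ?thesis unfolding potential_def xtilde_step_update by (simp add: algebra_simps)
qed

lemma gval_step:
  "gval P (xtilde_step P k i xh xt) - gval P xt = gblock P i (block_prox k i xh xt) - gblock P i (block_proj P i xt)"
  using block_prox_dom[of k i xh xt] by (simp add: xtilde_step_update gval_update block_dom_def)

text \<open>
  Averaging the blockwise estimates turns the sum over blocks into the full inner product with
  \<open>x\<^sup>* - xt\<close>, to which the extrapolation bound applies.
\<close>

lemma expected_progress:
  fixes k :: nat and xb xt :: "real^'p" and G :: real
  defines "xh \<equiv> xhat_of P k xb xt"
  defines "xt' \<equiv> \<lambda>i. xtilde_step P k i xh xt"
  defines "xb' \<equiv> \<lambda>i. xh + (tau P k / tau0 P) *\<^sub>R (xt' i - xt)"
    and "G' \<equiv> \<lambda>i. (1 - tau P k) * G + tau P k * gval P xt + tau P k / tau0 P * (gval P (xt' i) - gval P xt)"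
  assumes dom: "tau0 P = 1 \<or> xt \<in> gdom P"
  shows "(\<Sum>i\<in>UNIV. qprob P i * (ffun P (xb' i) + penalty P (beta P (Suc k)) (xb' i) + G' i - Fstar
        + tau P k * potential k (xt' i)))
    \<le> (1 - tau P k) * (ffun P xb + penalty P (beta P k) xb + G - Fstar) + tau P k * potential k xt"
proof -
  define t where "t = tau P k"
  define \<beta> where "\<beta> = beta P (Suc k)"
  define v where "v = gradient (ffun P) xh + transpose (Amat P) *v dual_point P \<beta> xh"
  let ?c = "\<lambda>i. block_proj P i xt" and ?s = "\<lambda>i. block_proj P i xstar"
  define K where "K = ffun P xh + penalty P \<beta> xh + (1 - t) * G + t * gval P xt - Fstar + t * potential k xt"
  have each: "ffun P (xb' i) + penalty P \<beta> (xb' i) + G' i - Fstar + t * potential k (xt' i)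
    \<le> K + t / qprob P i * (v \<bullet> (?s i - ?c i) + gblock P i (?s i) - gblock P i (?c i))" for i
  proof -
    have "tau0 P = 1 \<or> ?c i \<in> block_dom P i" using dom by (auto simp: gdom_def)
    from single_block_progress[OF this, of k xb, folded xh_def \<beta>_def, folded v_def t_def]
    show ?thesis
      unfolding G'_def xb'_def K_def t_def[symmetric] unfolding xt'_def gval_step potential_step
      by (simp add: algebra_simps)
  qed
  have "(\<Sum>i\<in>UNIV. qprob P i * (ffun P (xb' i) + penalty P \<beta> (xb' i) + G' i - Fstar + t * potential k (xt' i)))
    \<le> (\<Sum>i\<in>UNIV. qprob P i * (K + t / qprob P i * (v \<bullet> (?s i - ?c i) + gblock P i (?s i) - gblock P i (?c i))))"
    using q_pos by (intro sum_mono mult_left_mono each) (simp add: less_imp_le)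
  also have "\<dots> = (\<Sum>i\<in>UNIV. qprob P i * K + t * (v \<bullet> (?s i - ?c i) + gblock P i (?s i) - gblock P i (?c i)))"
    using q_pos by (intro sum.cong refl) (simp add: distrib_left less_imp_neq[symmetric])
  also have "\<dots> = K + t * (v \<bullet> (xstar - xt) + gval P xstar - gval P xt)"
    by (simp add: sum.distrib sum_subtractf sum_distrib_left[symmetric] sum_distrib_right[symmetric]
        sum_qprob gval_def inner_sum_right[symmetric] sum_block_proj)
  also have "\<dots> \<le> (1 - t) * (ffun P xb + penalty P (beta P k) xb + G - Fstar) + t * potential k xt"
    using extrapolation_bound[of k xb xt, folded xh_def \<beta>_def, folded v_def t_def]
    by (simp add: K_def Fstar_def algebra_simps)
  finally show ?thesis unfolding t_def \<beta>_def .
qed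

end

section \<open>Sample paths\<close>

lemma iterate_cong:
  "(\<And>j. j < k \<Longrightarrow> \<iota> j = \<iota>' j) \<Longrightarrow> iterate P \<iota> k = iterate P \<iota>' k"
  by (induction k) (auto simp: Let_def)

definition xtilde :: "('p::finite, 'n::finite, 'm::finite) cd_problem \<Rightarrow> (nat \<Rightarrow> 'n) \<Rightarrow> nat \<Rightarrow> real^'p" where
  "xtilde P \<iota> k = snd (iterate P \<iota> k)"

definition xhat :: "('p::finite, 'n::finite, 'm::finite) cd_problem \<Rightarrow> (nat \<Rightarrow> 'n) \<Rightarrow> nat \<Rightarrow> real^'p" where
  "xhat P \<iota> k = xhat_of P k (xbar P \<iota> k) (xtilde P \<iota> k)"

lemma xtilde_Suc: "xtilde P \<iota> (Suc k) = xtilde_step P k (\<iota> k) (xhat P \<iota> k) (xtilde P \<iota> k)"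
  and xbar_Suc: "xbar P \<iota> (Suc k)
    = xhat P \<iota> k + (tau P k / tau0 P) *\<^sub>R (xtilde P \<iota> (Suc k) - xtilde P \<iota> k)"
  by (simp_all add: xtilde_def xbar_def xhat_def Let_def)

text \<open>
  The averaged iterate is a convex combination of the prox iterates, but the value of \<open>g\<close> at it does
  not satisfy a usable recursion.  The surrogate is the same combination of the values of \<open>g\<close> at the
  prox iterates: it dominates the value of \<open>g\<close> and follows the recursion of the averaged iterate.
\<close>

primrec surrogate :: "('p::finite, 'n::finite, 'm::finite) cd_problem \<Rightarrow> (nat \<Rightarrow> 'n) \<Rightarrow> nat \<Rightarrow> real" where
  "surrogate P \<iota> 0 = gval P (xinit P)"
| "surrogate P \<iota> (Suc k) = (1 - tau P k) * surrogate P \<iota> k + tau P k * gval P (xtilde P \<iota> k)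
     + tau P k / tau0 P * (gval P (xtilde P \<iota> (Suc k)) - gval P (xtilde P \<iota> k))"

lemma xbar_cong: "(\<And>j. j < k \<Longrightarrow> \<iota> j = \<iota>' j) \<Longrightarrow> xbar P \<iota> k = xbar P \<iota>' k"
  and xtilde_cong: "(\<And>j. j < k \<Longrightarrow> \<iota> j = \<iota>' j) \<Longrightarrow> xtilde P \<iota> k = xtilde P \<iota>' k"
  by (simp_all add: xbar_def xtilde_def iterate_cong[of k \<iota> \<iota>'])

lemma surrogate_cong: "(\<And>j. j < k \<Longrightarrow> \<iota> j = \<iota>' j) \<Longrightarrow> surrogate P \<iota> k = surrogate P \<iota>' k"
proof (induction k)
  case (Suc k)
  have "xtilde P \<iota> k = xtilde P \<iota>' k" "xtilde P \<iota> (Suc k) = xtilde P \<iota>' (Suc k)"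
    by (rule xtilde_cong; use Suc.prems in simp)+
  with Suc show ?case by simp
qed simp

context cd_optimum
begin

definition gap :: "(nat \<Rightarrow> 'n) \<Rightarrow> nat \<Rightarrow> real" where
  "gap \<iota> k = ffun P (xbar P \<iota> k) + penalty P (beta P k) (xbar P \<iota> k) + surrogate P \<iota> k - Fstar"

definition lyapunov :: "nat \<Rightarrow> (nat \<Rightarrow> 'n) \<Rightarrow> real" where
  "lyapunov k \<iota> = gap \<iota> (Suc k) / tau P k + potential k (xtilde P \<iota> (Suc k))"

definition initial_const :: real where
  "initial_const = (1 - tau0 P) * (ffun P (xinit P) + penalty P (beta P 0) (xinit P) + gval P (xinit P) - Fstar)
     + tau0 P * potential 0 (xinit P)"

text \<open>
  If \<open>\<tau>\<^sub>0 = 1\<close> there is a single block and the first step forgets the value of \<open>g\<close> at the initial point,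
  so an initial point outside the domain does no harm.  Thus \<open>finite_start\<close> holds exactly when the
  constant \<open>Cstar\<close> is finite.
\<close>

definition finite_start :: bool where
  "finite_start \<longleftrightarrow> tau0 P = 1 \<or> xinit P \<in> gdom P"

lemma expected_progress_path:
  assumes dom: "tau0 P = 1 \<or> xtilde P \<iota> k \<in> gdom P"
  shows "(\<Sum>i\<in>UNIV. qprob P i * lyapunov k (\<iota>(k := i)))
    \<le> ((1 - tau P k) * gap \<iota> k + tau P k * potential k (xtilde P \<iota> k)) / tau P k"
proof -
  have same: "xbar P (\<iota>(k := i)) k = xbar P \<iota> k" "xtilde P (\<iota>(k := i)) k = xtilde P \<iota> k"
    "surrogate P (\<iota>(k := i)) k = surrogate P \<iota> k" for i
    by (auto intro!: xbar_cong xtilde_cong surrogate_cong)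
  then have hat: "xhat P (\<iota>(k := i)) k = xhat P \<iota> k" for i by (simp add: xhat_def)
  have "(\<Sum>i\<in>UNIV. qprob P i * (gap (\<iota>(k := i)) (Suc k) + tau P k * potential k (xtilde P (\<iota>(k := i)) (Suc k))))
    \<le> (1 - tau P k) * gap \<iota> k + tau P k * potential k (xtilde P \<iota> k)"
    using expected_progress[OF dom, where k = k and xb = "xbar P \<iota> k" and G = "surrogate P \<iota> k", folded xhat_def]
    unfolding gap_def surrogate.simps(2) xbar_Suc xtilde_Suc hat same by simp
  then have "(\<Sum>i\<in>UNIV. qprob P i * (gap (\<iota>(k := i)) (Suc k) + tau P k * potential k (xtilde P (\<iota>(k := i)) (Suc k)))) / tau P k
    \<le> ((1 - tau P k) * gap \<iota> k + tau P k * potential k (xtilde P \<iota> k)) / tau P k"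
    by (rule divide_right_mono) (use tau_pos[of k] in simp)
  moreover have "(\<Sum>i\<in>UNIV. qprob P i * (gap (\<iota>(k := i)) (Suc k) + tau P k * potential k (xtilde P (\<iota>(k := i)) (Suc k)))) / tau P k
    = (\<Sum>i\<in>UNIV. qprob P i * lyapunov k (\<iota>(k := i)))"
    unfolding sum_divide_distrib lyapunov_def using tau_pos[of k]
    by (intro sum.cong refl) (simp add: field_simps)
  ultimately show ?thesis by simp
qed

lemma lyapunov_start:
  assumes "finite_start"
  shows "(\<Sum>i\<in>UNIV. qprob P i * lyapunov 0 (\<iota>(0 := i))) \<le> initial_const / tau0 P"
proof -
  have "tau0 P = 1 \<or> xtilde P \<iota> 0 \<in> gdom P" using assms by (simp add: finite_start_def xtilde_def)
  from expected_progress_path[OF this] show ?thesis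
    by (simp add: initial_const_def gap_def xtilde_def xbar_def)
qed

text \<open>
  By \<open>beta_Suc\<close> the quotient \<open>\<tau>\<^sub>k / \<beta>\<^bsub>k+1\<^esub>\<close> is constant, so \<open>\<tau>\<^sub>k B\<^sub>k\<close> is a constant plus the
  decreasing term \<open>\<tau>\<^sub>k L\<close>.
\<close>

lemma dist_weight_decreasing: "dist_weight (Suc k) i \<le> dist_weight k i"
proof -
  have tB: "tau P k * Bconst P k i = tau P k * Lhat P i + tau0 P / beta1 P * (block_spectral_norm P i)\<^sup>2" for k
    using tau_pos[of k] tau0_pos beta1_pos
    by (simp add: Bconst_def step_const_def beta_Suc field_simps)
  have "tau P (Suc k) \<le> tau P k"
    using tau_pos[of k] by (simp add: divide_le_eq)
  then have "tau P (Suc k) * Bconst P (Suc k) i \<le> tau P k * Bconst P k i"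
    unfolding tB using Lhat_nonneg[of i] by (simp add: mult_right_mono del: tau.simps)
  then show ?thesis
    unfolding dist_weight_def using tau0_pos q_pos[of i] by (intro divide_right_mono) auto
qed

lemma potential_decreasing: "potential (Suc k) x \<le> potential k x"
  unfolding potential_def by (intro sum_mono mult_right_mono dist_weight_decreasing) simp

text \<open>
  After division by \<open>\<tau>\<close> the contraction factor \<open>1 - \<tau>\<close> becomes the reciprocal of the preceding \<open>\<tau>\<close>, so
  the recursion telescopes: \<open>lyapunov\<close> is a supermartingale.
\<close>

lemma lyapunov_step:
  assumes "xtilde P \<iota> (Suc k) \<in> gdom P"
  shows "(\<Sum>i\<in>UNIV. qprob P i * lyapunov (Suc k) (\<iota>(Suc k := i))) \<le> lyapunov k \<iota>"
proof -
  define t where "t = tau P (Suc k)"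
  have t: "0 < t" "1 - t = t / tau P k" using tau_pos[of "Suc k"] one_minus_tau_Suc by (auto simp: t_def)
  have "(\<Sum>i\<in>UNIV. qprob P i * lyapunov (Suc k) (\<iota>(Suc k := i)))
    \<le> ((1 - t) * gap \<iota> (Suc k) + t * potential (Suc k) (xtilde P \<iota> (Suc k))) / t"
    using expected_progress_path[of \<iota> "Suc k"] assms unfolding t_def by blast
  also have "\<dots> = gap \<iota> (Suc k) / tau P k + potential (Suc k) (xtilde P \<iota> (Suc k))"
    unfolding t(2) using t(1) tau_pos[of k] by (simp add: field_simps)
  also have "\<dots> \<le> lyapunov k \<iota>"
    unfolding lyapunov_def using potential_decreasing by simp
  finally show ?thesis .
qed

lemma tau0_eq_1_single_block:
  assumes "tau0 P = 1"
  shows "i = (j :: 'n)"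
proof (rule ccontr)
  assume "i \<noteq> j"
  have "sum (qprob P) {i, j} \<le> sum (qprob P) UNIV"
    using q_pos by (intro sum_mono2) (auto intro: less_imp_le)
  then show False
    using \<open>i \<noteq> j\<close> tau0_le[of i] tau0_le[of j] assms by (simp add: sum_qprob)
qed

lemma xtilde_Suc_gdom: "finite_start \<Longrightarrow> xtilde P \<iota> (Suc k) \<in> gdom P"
proof (induction k)
  case 0
  have z: "block_prox 0 (\<iota> 0) xh xt \<in> block_dom P (\<iota> 0)" for xh xt by (rule block_prox_dom)
  then have zs: "block_prox 0 (\<iota> 0) xh xt \<in> block_space P (\<iota> 0)" for xh xt by (simp add: block_dom_def)
  show ?case
  proof (cases "xinit P \<in> gdom P")
    case True
    then show ?thesis
      using z zs by (simp add: xtilde_Suc xtilde_step_update update_in_gdom) (simp add: xtilde_def update_in_gdom)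
  next
    case False
    then have "tau0 P = 1" using 0 by (simp add: finite_start_def)
    then have j: "j = \<iota> 0" for j by (rule tau0_eq_1_single_block)
    show ?thesis
      unfolding gdom_def mem_Collect_eq
    proof
      fix j
      show "block_proj P j (xtilde P \<iota> (Suc 0)) \<in> block_dom P j"
        unfolding j[of j] xtilde_Suc xtilde_step_update by (simp add: block_proj_update[OF zs] z)
    qed
  qed
next
  case (Suc k)
  show ?case
    unfolding xtilde_Suc[of P \<iota> "Suc k"] xtilde_step_update
    using update_in_gdom[OF Suc.IH[OF Suc.prems]] block_prox_dom by (auto simp: block_dom_def)
qed

text \<open>
  The last prox iterate has weight \<open>\<tau>\<^sub>k / \<tau>\<^sub>0\<close> in the averaged iterate; the remaining mass is collected in
  one point of the epigraph of \<open>g\<close>.  In the next step the old prox iterate keeps the weight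
  \<open>(1 - \<tau>) \<tau>\<^sub>k / \<tau>\<^sub>0 + \<tau> - \<tau> / \<tau>\<^sub>0 = \<tau>\<close>, with \<open>\<tau>\<close> the next value of \<open>tau\<close>, which is nonnegative.
\<close>

lemma xbar_representation:
  assumes "finite_start"
  shows "\<exists>w r. w \<in> gdom P \<and> gval P w \<le> r
    \<and> xbar P \<iota> (Suc k) = (1 - tau P k / tau0 P) *\<^sub>R w + (tau P k / tau0 P) *\<^sub>R xtilde P \<iota> (Suc k)
    \<and> surrogate P \<iota> (Suc k) = (1 - tau P k / tau0 P) * r + tau P k / tau0 P * gval P (xtilde P \<iota> (Suc k))"
proof (induction k)
  case 0
  have "xhat P \<iota> 0 = xtilde P \<iota> 0"
    by (simp add: xhat_def xhat_of_def xbar_def xtilde_def algebra_simps)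
  moreover have "surrogate P \<iota> 0 = gval P (xtilde P \<iota> 0)" by (simp add: xtilde_def)
  ultimately show ?case
    using xtilde_Suc_gdom[OF assms, of \<iota> 0] tau0_pos
    by (intro exI[of _ "xtilde P \<iota> 1"] exI[of _ "gval P (xtilde P \<iota> 1)"]) (simp add: xbar_Suc algebra_simps)
next
  case (Suc k)
  then obtain w r where w: "w \<in> gdom P" "gval P w \<le> r"
    and xb: "xbar P \<iota> (Suc k) = (1 - tau P k / tau0 P) *\<^sub>R w + (tau P k / tau0 P) *\<^sub>R xtilde P \<iota> (Suc k)"
    and G: "surrogate P \<iota> (Suc k) = (1 - tau P k / tau0 P) * r + tau P k / tau0 P * gval P (xtilde P \<iota> (Suc k))"
    by blast
  define t where "t = tau P (Suc k)"
  define c where "c = tau P k / tau0 P"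
  define d where "d = t / tau0 P"
  define y where "y = xtilde P \<iota> (Suc k)"
  define y' where "y' = xtilde P \<iota> (Suc (Suc k))"
  have y: "y \<in> gdom P" unfolding y_def by (rule xtilde_Suc_gdom[OF assms])
  have t0: "0 < tau0 P" by (rule tau0_pos)
  have t: "0 < t" "t \<le> 1" unfolding t_def by (rule tau_pos tau_le_1)+
  have cd: "(1 - t) * c = d"
    using tau_pos[of k] by (simp only: t_def d_def c_def one_minus_tau_Suc) simp
  have d1: "d < 1"
  proof -
    have "tau P (Suc k) < tau0 P"
      using tau0_pos denom_pos[of k] unfolding tau_eq by (simp add: divide_less_eq add_pos_nonneg)
    then show ?thesis using tau0_pos by (simp add: d_def t_def del: tau.simps)
  qed
  \<comment> \<open>The new remainder weight is \<open>1 - d = (1 - t) (1 - c) + t\<close>.\<close>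
  define s where "s = t / (1 - d)"
  have split1: "(1 - d) * s = t" using d1 by (simp add: s_def)
  have "(1 - d) * (1 - s) = 1 - d - (1 - d) * s" by (simp add: algebra_simps)
  also have "\<dots> = 1 - (1 - t) * c - t" using split1 cd by simp
  also have "\<dots> = (1 - t) * (1 - c)" by (simp add: algebra_simps)
  finally have split: "(1 - d) * s = t" "(1 - d) * (1 - s) = (1 - t) * (1 - c)" using split1 by auto
  have c1: "c \<le> 1"
    using denom_pos[of k] tau0_pos unfolding c_def tau_eq by (simp add: divide_le_eq)
  have "0 \<le> (1 - d) * (1 - s)" unfolding split using t c1 by simp
  then have s: "0 \<le> s" "s \<le> 1" using d1 t by (auto simp: s_def zero_le_mult_iff)
  define w' where "w' = (1 - s) *\<^sub>R w + s *\<^sub>R y"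
  define r' where "r' = (1 - s) * r + s * gval P y"
  have w': "w' \<in> gdom P" "gval P w' \<le> r'"
    using gval_convex[OF w(1) y w(2) order_refl s] by (simp_all add: w'_def r'_def)
  have sw: "(1 - d) *\<^sub>R w' = ((1 - t) * (1 - c)) *\<^sub>R w + t *\<^sub>R y"
    unfolding w'_def scaleR_add_right scaleR_scaleR split ..
  have sr: "(1 - d) * r' = ((1 - t) * (1 - c)) * r + t * gval P y"
    unfolding r'_def distrib_left mult.assoc[symmetric] split ..
  have "xbar P \<iota> (Suc (Suc k)) = (1 - t) *\<^sub>R ((1 - c) *\<^sub>R w + c *\<^sub>R y) + t *\<^sub>R y + d *\<^sub>R (y' - y)"
    unfolding xbar_Suc[of P \<iota> "Suc k"] xhat_def xhat_of_def xb
    by (simp add: t_def c_def d_def y_def y'_def del: tau.simps)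
  also have "\<dots> = ((1 - t) * (1 - c)) *\<^sub>R w + ((1 - t) * c) *\<^sub>R y + t *\<^sub>R y + d *\<^sub>R (y' - y)"
    by (simp add: scaleR_add_right)
  also have "\<dots> = (1 - d) *\<^sub>R w' + d *\<^sub>R y'" unfolding sw cd by (simp add: scaleR_diff_right)
  finally have 1: "xbar P \<iota> (Suc (Suc k)) = (1 - d) *\<^sub>R w' + d *\<^sub>R y'" .
  have "surrogate P \<iota> (Suc (Suc k)) = (1 - t) * ((1 - c) * r + c * gval P y) + t * gval P y + d * (gval P y' - gval P y)"
    unfolding surrogate.simps(2)[of P \<iota> "Suc k"] G
    by (simp add: t_def c_def d_def y_def y'_def del: tau.simps)
  also have "\<dots> = ((1 - t) * (1 - c)) * r + ((1 - t) * c) * gval P y + t * gval P y + d * (gval P y' - gval P y)"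
    by (simp add: distrib_left)
  also have "\<dots> = (1 - d) * r' + d * gval P y'" unfolding sr cd by (simp add: algebra_simps)
  finally have 2: "surrogate P \<iota> (Suc (Suc k)) = (1 - d) * r' + d * gval P y'" .
  from w' 1 2 show ?case unfolding d_def t_def y'_def by blast
qed

lemma surrogate_bound:
  assumes "finite_start"
  shows "xbar P \<iota> (Suc k) \<in> gdom P" "gval P (xbar P \<iota> (Suc k)) \<le> surrogate P \<iota> (Suc k)"
proof -
  obtain w r where w: "w \<in> gdom P" "gval P w \<le> r"
    and xb: "xbar P \<iota> (Suc k) = (1 - tau P k / tau0 P) *\<^sub>R w + (tau P k / tau0 P) *\<^sub>R xtilde P \<iota> (Suc k)"
    and G: "surrogate P \<iota> (Suc k) = (1 - tau P k / tau0 P) * r + tau P k / tau0 P * gval P (xtilde P \<iota> (Suc k))"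
    using xbar_representation[OF assms] by blast
  have "0 \<le> tau P k / tau0 P" "tau P k / tau0 P \<le> 1"
    using denom_pos[of k] tau0_pos unfolding tau_eq by (simp_all add: divide_le_eq)
  from gval_convex[OF w(1) xtilde_Suc_gdom[OF assms] w(2) order_refl this]
  show "xbar P \<iota> (Suc k) \<in> gdom P" "gval P (xbar P \<iota> (Suc k)) \<le> surrogate P \<iota> (Suc k)"
    unfolding xb G .
qed

lemma gap_le_lyapunov: "gap \<iota> (Suc k) \<le> tau P k * lyapunov k \<iota>"
proof -
  have "0 \<le> dist_weight k i" for i
    unfolding dist_weight_def
    using tau_pos[of k] Bconst_nonneg[of k i] tau0_pos q_pos[of i] by simp
  then have "0 \<le> potential k x" for x unfolding potential_def by (intro sum_nonneg) simp
  then show ?thesis using tau_pos[of k] by (simp add: lyapunov_def distrib_left)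
qed

end

section \<open>Functions of finitely many independent draws\<close>

definition depends_on_prefix :: "nat \<Rightarrow> ((nat \<Rightarrow> 'n) \<Rightarrow> 'b) \<Rightarrow> bool" where
  "depends_on_prefix k F \<longleftrightarrow> (\<forall>\<iota> \<iota>'. (\<forall>j<k. \<iota> j = \<iota>' j) \<longrightarrow> F \<iota> = F \<iota>')"

lemma depends_on_prefix_restrict:
  "depends_on_prefix k F \<Longrightarrow> F (restrict \<iota> {..<k}) = F \<iota>"
  unfolding depends_on_prefix_def by (elim allE[of _ "restrict \<iota> {..<k}"] allE[of _ \<iota>]) auto

lemma measurable_prefix_function:
  fixes F :: "(nat \<Rightarrow> 'n::finite) \<Rightarrow> real"
  shows "F \<in> borel_measurable (PiM {..<k} (\<lambda>_. count_space UNIV))"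
  by (subst count_space_PiM_finite) (auto simp: countable_finite)

context prob_space
begin

lemma integrable_prefix:
  fixes idx :: "nat \<Rightarrow> 'a \<Rightarrow> 'n::finite" and F :: "(nat \<Rightarrow> 'n) \<Rightarrow> real"
  assumes idx: "\<And>j. idx j \<in> measurable M (count_space UNIV)" and F: "depends_on_prefix k F"
  shows "integrable M (\<lambda>\<omega>. F (\<lambda>j. idx j \<omega>))"
proof (rule integrable_const_bound)
  let ?E = "PiE {..<k} (\<lambda>_. UNIV :: 'n set)"
  have "finite ?E" by (intro finite_PiE) auto
  then have "\<bar>F \<iota>\<bar> \<le> Max ((\<lambda>e. \<bar>F e\<bar>) ` ?E)" for \<iota>
    unfolding depends_on_prefix_restrict[OF F, of \<iota>, symmetric] by (intro Max_ge) auto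
  then show "AE \<omega> in M. norm (F (\<lambda>j. idx j \<omega>)) \<le> Max ((\<lambda>e. \<bar>F e\<bar>) ` ?E)" by simp
  have "(\<lambda>\<omega>. F (restrict (\<lambda>j. idx j \<omega>) {..<k})) \<in> borel_measurable M"
    by (rule measurable_compose[OF measurable_restrict measurable_prefix_function]) (rule idx)
  then show "(\<lambda>\<omega>. F (\<lambda>j. idx j \<omega>)) \<in> borel_measurable M"
    by (simp add: depends_on_prefix_restrict[OF F])
qed

text \<open>
  Split according to the value of the last draw; conditioned on that value, the remaining function
  depends on the earlier draws only and is independent of the event.
\<close>

lemma expectation_fresh_draw:
  fixes idx :: "nat \<Rightarrow> 'a \<Rightarrow> 'n::finite" and F :: "(nat \<Rightarrow> 'n) \<Rightarrow> real"
  assumes indep: "indep_vars (\<lambda>_. count_space UNIV) idx UNIV"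
    and distr: "\<And>i. measure M {\<omega> \<in> space M. idx k \<omega> = i} = q i"
    and F: "depends_on_prefix (Suc k) F"
  shows "expectation (\<lambda>\<omega>. F (\<lambda>j. idx j \<omega>)) = expectation (\<lambda>\<omega>. \<Sum>i\<in>UNIV. q i * F ((\<lambda>j. idx j \<omega>)(k := i)))"
proof -
  have idx: "idx j \<in> measurable M (count_space UNIV)" for j
    using indep by (auto simp: indep_vars_def)
  have Fi: "depends_on_prefix k (\<lambda>\<iota>. F (\<iota>(k := i)))" for i
    using F unfolding depends_on_prefix_def by (auto simp: less_Suc_eq)
  have intF: "integrable M (\<lambda>\<omega>. F ((\<lambda>j. idx j \<omega>)(k := i)))" for i
    by (rule integrable_prefix[OF idx Fi])
  have "depends_on_prefix (Suc k) (\<lambda>\<iota>. of_bool (\<iota> k = i) :: real)" for i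
    by (auto simp: depends_on_prefix_def)
  then have int1: "integrable M (\<lambda>\<omega>. of_bool (idx k \<omega> = i) :: real)" for i
    by (rule integrable_prefix[OF idx])
  have q: "expectation (\<lambda>\<omega>. of_bool (idx k \<omega> = i)) = q i" for i
  proof -
    have "expectation (\<lambda>\<omega>. of_bool (idx k \<omega> = i)) = expectation (indicator {\<omega> \<in> space M. idx k \<omega> = i})"
      by (intro Bochner_Integration.integral_cong) (auto simp: indicator_def)
    also have "\<dots> = prob ({\<omega> \<in> space M. idx k \<omega> = i} \<inter> space M)"
      by (rule Bochner_Integration.integral_indicator)
    also have "{\<omega> \<in> space M. idx k \<omega> = i} \<inter> space M = {\<omega> \<in> space M. idx k \<omega> = i}" by auto
    finally show ?thesis using distr[of i] by simp
  qed
  have ind: "indep_var borel (\<lambda>\<omega>. of_bool (idx k \<omega> = i) :: real) borel (\<lambda>\<omega>. F ((\<lambda>j. idx j \<omega>)(k := i)))" for i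
  proof -
    have "indep_var (PiM {k} (\<lambda>_. count_space UNIV)) (\<lambda>\<omega>. restrict (\<lambda>j. idx j \<omega>) {k})
        (PiM {..<k} (\<lambda>_. count_space UNIV)) (\<lambda>\<omega>. restrict (\<lambda>j. idx j \<omega>) {..<k})"
      by (rule indep_var_restrict[OF indep]) auto
    moreover have "(\<lambda>\<iota>. of_bool (\<iota> k = i) :: real) \<in> borel_measurable (PiM {k} (\<lambda>_. count_space UNIV))"
      by (subst count_space_PiM_finite) (auto simp: countable_finite)
    ultimately have "indep_var borel ((\<lambda>\<iota>. of_bool (\<iota> k = i) :: real) \<circ> (\<lambda>\<omega>. restrict (\<lambda>j. idx j \<omega>) {k}))
        borel ((\<lambda>\<iota>. F (\<iota>(k := i))) \<circ> (\<lambda>\<omega>. restrict (\<lambda>j. idx j \<omega>) {..<k}))"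
      by (rule indep_var_compose) (rule measurable_prefix_function)
    then show ?thesis
      unfolding o_def depends_on_prefix_restrict[OF Fi] by simp
  qed
  have "expectation (\<lambda>\<omega>. F (\<lambda>j. idx j \<omega>))
      = expectation (\<lambda>\<omega>. \<Sum>i\<in>UNIV. of_bool (idx k \<omega> = i) * F ((\<lambda>j. idx j \<omega>)(k := i)))"
  proof (rule Bochner_Integration.integral_cong[OF refl])
    fix \<omega>
    have "(\<Sum>i\<in>UNIV. of_bool (idx k \<omega> = i) * F ((\<lambda>j. idx j \<omega>)(k := i)))
        = (\<Sum>i\<in>UNIV. if i = idx k \<omega> then F ((\<lambda>j. idx j \<omega>)(k := i)) else 0)"
      by (intro sum.cong) auto
    then show "F (\<lambda>j. idx j \<omega>) = (\<Sum>i\<in>UNIV. of_bool (idx k \<omega> = i) * F ((\<lambda>j. idx j \<omega>)(k := i)))"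
      by (simp add: fun_upd_def cong: if_cong) (rule arg_cong[of _ _ F], auto)
  qed
  also have "\<dots> = (\<Sum>i\<in>UNIV. expectation (\<lambda>\<omega>. of_bool (idx k \<omega> = i) * F ((\<lambda>j. idx j \<omega>)(k := i))))"
    by (rule Bochner_Integration.integral_sum) (rule indep_var_integrable[OF ind int1 intF])
  also have "\<dots> = (\<Sum>i\<in>UNIV. q i * expectation (\<lambda>\<omega>. F ((\<lambda>j. idx j \<omega>)(k := i))))"
    by (simp only: indep_var_lebesgue_integral[OF ind int1 intF] q)
  also have "\<dots> = expectation (\<lambda>\<omega>. \<Sum>i\<in>UNIV. q i * F ((\<lambda>j. idx j \<omega>)(k := i)))"
    using intF by simp
  finally show ?thesis .
qed

end

section \<open>Extended-real expectations\<close>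

text \<open>
  The nonnegative integral is monotone on all functions, so the extended-valued objective can be
  handled by bounding it pointwise by real-valued integrable functions.
\<close>

lemma ext_expectation_mono:
  "(\<And>\<omega>. X \<omega> \<le> Y \<omega>) \<Longrightarrow> ext_expectation M X \<le> ext_expectation M Y"
  unfolding ext_expectation_def
  by (intro ereal_minus_mono) (auto intro!: nn_integral_mono e2ennreal_mono simp: less_eq_ennreal.rep_eq[symmetric])

lemma ext_expectation_ereal:
  assumes "integrable M (f :: 'a \<Rightarrow> real)"
  shows "ext_expectation M (\<lambda>\<omega>. ereal (f \<omega>)) = ereal (integral\<^sup>L M f)"
proof -
  have fin: "(\<integral>\<^sup>+\<omega>. ennreal (f \<omega>) \<partial>M) \<noteq> \<infinity>" "(\<integral>\<^sup>+\<omega>. ennreal (- f \<omega>) \<partial>M) \<noteq> \<infinity>"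
    using assms by (auto simp: real_integrable_def)
  obtain a b where a: "0 \<le> a" "(\<integral>\<^sup>+\<omega>. ennreal (f \<omega>) \<partial>M) = ennreal a"
    and b: "0 \<le> b" "(\<integral>\<^sup>+\<omega>. ennreal (- f \<omega>) \<partial>M) = ennreal b"
    using fin by (metis ennreal_cases infinity_ennreal_def)
  have "integral\<^sup>L M f = a - b" using a b by (simp add: real_lebesgue_integral_def[OF assms])
  then show ?thesis
    using a b by (simp add: ext_expectation_def e2ennreal_ereal enn2ereal_ennreal)
qed

section \<open>Convergence rates\<close>

definition residual :: "('p::finite, 'n::finite, 'm::finite) cd_problem \<Rightarrow> (nat \<Rightarrow> 'n) \<Rightarrow> nat \<Rightarrow> real" where
  "residual P \<iota> k = norm (Amat P *v xbar P \<iota> k - cvec P)"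

lemma residual_prefix: "depends_on_prefix k (\<lambda>\<iota>. residual P \<iota> k)"
proof -
  have "xbar P \<iota> k = xbar P \<iota>' k" if "\<forall>j<k. \<iota> j = \<iota>' j" for \<iota> \<iota>'
    by (rule xbar_cong) (use that in blast)
  then show ?thesis unfolding depends_on_prefix_def residual_def by metis
qed

context cd_optimum
begin

lemma gap_prefix: "depends_on_prefix k (\<lambda>\<iota>. gap \<iota> k)"
  unfolding depends_on_prefix_def
proof (intro allI impI)
  fix \<iota> \<iota>' :: "nat \<Rightarrow> 'n" assume eq: "\<forall>j<k. \<iota> j = \<iota>' j"
  have "xbar P \<iota> k = xbar P \<iota>' k" "surrogate P \<iota> k = surrogate P \<iota>' k"
    by (rule xbar_cong surrogate_cong; use eq in blast)+
  then show "gap \<iota> k = gap \<iota>' k" by (simp only: gap_def)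
qed

lemma lyapunov_prefix: "depends_on_prefix (Suc k) (lyapunov k)"
  unfolding depends_on_prefix_def
proof (intro allI impI)
  fix \<iota> \<iota>' :: "nat \<Rightarrow> 'n" assume eq: "\<forall>j<Suc k. \<iota> j = \<iota>' j"
  then have "gap \<iota> (Suc k) = gap \<iota>' (Suc k)" using gap_prefix[of "Suc k"] unfolding depends_on_prefix_def by blast
  moreover have "xtilde P \<iota> (Suc k) = xtilde P \<iota>' (Suc k)" by (rule xtilde_cong) (use eq in simp)
  ultimately show "lyapunov k \<iota> = lyapunov k \<iota>'" by (simp add: lyapunov_def)
qed

lemma objective_lower: "ereal (- (norm ystar * residual P \<iota> k)) \<le> objective P (xbar P \<iota> k) - opt_value P"
proof (cases "xbar P \<iota> k \<in> gdom P")
  case True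
  have "(Amat P *v xbar P \<iota> k - cvec P) \<bullet> ystar \<le> norm ystar * residual P \<iota> k"
    unfolding residual_def by (subst mult.commute) (rule norm_cauchy_schwarz)
  then show ?thesis
    using lagrangian_ge_Fstar[OF True] by (simp add: objective_in[OF True] opt_value_Fstar)
qed (simp add: objective_notin opt_value_Fstar)

text \<open>
  The Lagrangian bound makes the objective part at least \<open>- \<langle>r, y\<^sup>*\<rangle>\<close>, and the penalty contributes
  \<open>\<langle>r, ydot\<rangle> + \<parallel>r\<parallel>\<^sup>2 / (2 \<beta>)\<close>, where \<open>r\<close> is the residual vector.
\<close>

lemma gap_lower:
  assumes "finite_start"
  shows "- (norm (ystar - ydot P) * residual P \<iota> (Suc k)) + (residual P \<iota> (Suc k))\<^sup>2 / (2 * beta P (Suc k))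
    \<le> gap \<iota> (Suc k)"
proof -
  let ?r = "Amat P *v xbar P \<iota> (Suc k) - cvec P"
  note b = surrogate_bound[OF assms, of \<iota> k]
  have "Fstar \<le> ffun P (xbar P \<iota> (Suc k)) + surrogate P \<iota> (Suc k) + ?r \<bullet> ystar"
    using lagrangian_ge_Fstar[OF b(1)] b(2) by simp
  moreover have "?r \<bullet> (ystar - ydot P) \<le> norm (ystar - ydot P) * norm ?r"
    by (subst mult.commute) (rule norm_cauchy_schwarz)
  ultimately show ?thesis
    unfolding gap_def penalty_def h_smooth_eq[OF beta_Suc_pos] residual_def by (simp add: inner_diff_right)
qed

text \<open>
  The penalty is a supremum over \<open>y\<close>, bounded below by its value at the dual solution.
\<close>

lemma objective_upper:
  assumes "finite_start"
  shows "objective P (xbar P \<iota> (Suc k)) - opt_value P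
    \<le> ereal (gap \<iota> (Suc k) + norm ystar * residual P \<iota> (Suc k) + beta P (Suc k) / 2 * (norm (ystar - ydot P))\<^sup>2)"
proof -
  let ?r = "Amat P *v xbar P \<iota> (Suc k) - cvec P"
  note b = surrogate_bound[OF assms, of \<iota> k]
  have "?r \<bullet> ystar - beta P (Suc k) / 2 * (norm (ystar - ydot P))\<^sup>2 \<le> penalty P (beta P (Suc k)) (xbar P \<iota> (Suc k))"
    unfolding penalty_def by (rule h_smooth_ge[OF beta_Suc_pos])
  moreover have "- (?r \<bullet> ystar) \<le> norm ystar * norm ?r"
    by (metis inner_minus_left mult.commute norm_cauchy_schwarz norm_minus_cancel)
  ultimately show ?thesis
    using b(2) by (simp add: objective_in[OF b(1)] opt_value_Fstar gap_def residual_def)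
qed

lemma Cstar_finite:
  assumes "finite_start"
  shows "Cstar P xstar = ereal initial_const"
proof -
  have "tau0 P * dist_weight 0 i = tau0 P * Bconst P 0 i / (2 * qprob P i)" for i
    using tau0_pos by (simp add: dist_weight_def)
  then have pot: "tau0 P * potential 0 (xinit P)
      = (\<Sum>i\<in>UNIV. tau0 P * Bconst P 0 i / (2 * qprob P i) * (block_norm P (block_proj P i (xstar - xinit P)))\<^sup>2)"
    unfolding potential_def sum_distrib_left block_proj_diff by (simp add: mult.assoc[symmetric])
  have "ereal (1 - tau0 P) * (F_smooth P (beta P 0) (xinit P) - opt_value P)
    = ereal ((1 - tau0 P) * (ffun P (xinit P) + penalty P (beta P 0) (xinit P) + gval P (xinit P) - Fstar))"
  proof (cases "xinit P \<in> gdom P")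
    case True
    then show ?thesis
      by (simp add: F_smooth_def objective_in opt_value_Fstar penalty_def algebra_simps del: beta.simps)
  next
    case False
    then show ?thesis using assms by (simp add: finite_start_def zero_ereal_def[symmetric])
  qed
  then show ?thesis
    unfolding Cstar_def initial_const_def pot by simp
qed

lemma Cstar_infinite:
  assumes "\<not> finite_start"
  shows "Cstar P xstar = \<infinity>"
proof -
  have "tau0 P < 1" "xinit P \<notin> gdom P" using assms tau0_le_1 by (auto simp: finite_start_def)
  then show ?thesis
    by (simp add: Cstar_def F_smooth_def objective_notin opt_value_Fstar)
qed

context
  fixes M :: "'w measure" and idx :: "nat \<Rightarrow> 'w \<Rightarrow> 'n"
  assumes prob: "prob_space M"
    and indep: "prob_space.indep_vars M (\<lambda>_. count_space UNIV) idx UNIV"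
    and distr: "\<And>k i. measure M {\<omega> \<in> space M. idx k \<omega> = i} = qprob P i"
begin

interpretation prob_space M by (rule prob)

lemma integrable_path:
  fixes F :: "(nat \<Rightarrow> 'n) \<Rightarrow> real"
  assumes "depends_on_prefix k F"
  shows "integrable M (\<lambda>\<omega>. F (\<lambda>j. idx j \<omega>))"
  using indep assms by (intro integrable_prefix) (auto simp: indep_vars_def)

lemma expected_lyapunov:
  assumes "finite_start"
  shows "expectation (\<lambda>\<omega>. lyapunov k (\<lambda>j. idx j \<omega>)) \<le> initial_const / tau0 P"
proof (induction k)
  have dep: "depends_on_prefix (Suc k) (\<lambda>\<iota>. \<Sum>i\<in>UNIV. qprob P i * lyapunov k (\<iota>(k := i)))" for k
    unfolding depends_on_prefix_def
  proof (intro allI impI sum.cong refl)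
    fix \<iota> \<iota>' :: "nat \<Rightarrow> 'n" and i assume "\<forall>j<Suc k. \<iota> j = \<iota>' j"
    then have "\<forall>j<Suc k. (\<iota>(k := i)) j = (\<iota>'(k := i)) j" by simp
    then have "lyapunov k (\<iota>(k := i)) = lyapunov k (\<iota>'(k := i))"
      using lyapunov_prefix[of k] unfolding depends_on_prefix_def by blast
    then show "qprob P i * lyapunov k (\<iota>(k := i)) = qprob P i * lyapunov k (\<iota>'(k := i))" by simp
  qed
  note int = integrable_path[OF dep] and fresh = expectation_fresh_draw[OF indep distr lyapunov_prefix]
  {
    case 0
    show ?case
      unfolding fresh[of 0] using lyapunov_start[OF assms] by (intro integral_le_const int) auto
  next
    case (Suc k)
    have "expectation (\<lambda>\<omega>. lyapunov (Suc k) (\<lambda>j. idx j \<omega>)) \<le> expectation (\<lambda>\<omega>. lyapunov k (\<lambda>j. idx j \<omega>))"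
      unfolding fresh[of "Suc k"]
      by (intro integral_mono int integrable_path[OF lyapunov_prefix] lyapunov_step xtilde_Suc_gdom assms)
    with Suc show ?case by simp
  }
qed

lemma expected_gap:
  assumes "finite_start"
  shows "expectation (\<lambda>\<omega>. gap (\<lambda>j. idx j \<omega>) (Suc k)) \<le> initial_const / (1 + real k * tau0 P)"
proof -
  have "expectation (\<lambda>\<omega>. gap (\<lambda>j. idx j \<omega>) (Suc k)) \<le> expectation (\<lambda>\<omega>. tau P k * lyapunov k (\<lambda>j. idx j \<omega>))"
    by (intro integral_mono integrable_path[OF gap_prefix] integrable_mult_right
        integrable_path[OF lyapunov_prefix] gap_le_lyapunov)
  also have "\<dots> = tau P k * expectation (\<lambda>\<omega>. lyapunov k (\<lambda>j. idx j \<omega>))" by simp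
  also have "\<dots> \<le> tau P k * (initial_const / tau0 P)"
    using tau_pos[of k] by (intro mult_left_mono expected_lyapunov[OF assms]) simp
  also have "\<dots> = initial_const / (1 + real k * tau0 P)"
    using tau0_pos by (simp add: tau_eq)
  finally show ?thesis .
qed

lemma expected_objective_lower:
  "ereal (- (norm ystar * (\<integral>\<omega>. residual P (\<lambda>j. idx j \<omega>) k \<partial>M)))
    \<le> ext_expectation M (\<lambda>\<omega>. objective P (xbar P (\<lambda>j. idx j \<omega>) k) - opt_value P)"
proof -
  have int: "integrable M (\<lambda>\<omega>. - (norm ystar * residual P (\<lambda>j. idx j \<omega>) k))"
    using integrable_path[OF residual_prefix[where P = P]] by simp
  have "ereal (- (norm ystar * (\<integral>\<omega>. residual P (\<lambda>j. idx j \<omega>) k \<partial>M)))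
      = ext_expectation M (\<lambda>\<omega>. ereal (- (norm ystar * residual P (\<lambda>j. idx j \<omega>) k)))"
    using ext_expectation_ereal[OF int] by simp
  also have "\<dots> \<le> ext_expectation M (\<lambda>\<omega>. objective P (xbar P (\<lambda>j. idx j \<omega>) k) - opt_value P)"
    by (rule ext_expectation_mono) (rule objective_lower)
  finally show ?thesis .
qed

lemma expected_objective_upper:
  assumes "finite_start"
  shows "ext_expectation M (\<lambda>\<omega>. objective P (xbar P (\<lambda>j. idx j \<omega>) (Suc k)) - opt_value P)
    \<le> ereal (initial_const / (1 + real k * tau0 P)
        + beta1 P * (norm (ystar - ydot P))\<^sup>2 / (2 * (1 + real k * tau0 P))
        + norm ystar * (\<integral>\<omega>. residual P (\<lambda>j. idx j \<omega>) (Suc k) \<partial>M))"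
proof -
  let ?f = "\<lambda>\<iota>. gap \<iota> (Suc k) + norm ystar * residual P \<iota> (Suc k) + beta P (Suc k) / 2 * (norm (ystar - ydot P))\<^sup>2"
  have int: "integrable M (\<lambda>\<omega>. ?f (\<lambda>j. idx j \<omega>))"
    using integrable_path[OF residual_prefix[where P = P]] integrable_path[OF gap_prefix] by simp
  have "ext_expectation M (\<lambda>\<omega>. objective P (xbar P (\<lambda>j. idx j \<omega>) (Suc k)) - opt_value P)
      \<le> ereal (expectation (\<lambda>\<omega>. ?f (\<lambda>j. idx j \<omega>)))"
    unfolding ext_expectation_ereal[OF int, symmetric]
    by (rule ext_expectation_mono) (rule objective_upper[OF assms])
  also have "expectation (\<lambda>\<omega>. ?f (\<lambda>j. idx j \<omega>)) = expectation (\<lambda>\<omega>. gap (\<lambda>j. idx j \<omega>) (Suc k))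
      + norm ystar * expectation (\<lambda>\<omega>. residual P (\<lambda>j. idx j \<omega>) (Suc k)) + beta P (Suc k) / 2 * (norm (ystar - ydot P))\<^sup>2"
    using integrable_path[OF residual_prefix[where P = P]] integrable_path[OF gap_prefix] by (simp add: prob_space)
  also have "beta P (Suc k) / 2 * (norm (ystar - ydot P))\<^sup>2
      = beta1 P * (norm (ystar - ydot P))\<^sup>2 / (2 * (1 + real k * tau0 P))"
    unfolding beta_Suc tau_eq using tau0_pos by simp
  finally show ?thesis
    using expected_gap[OF assms, of k] by (elim order_trans) simp
qed

text \<open>
  The expected gap is bounded below by a quadratic polynomial in the expected residual, whose leading
  coefficient is \<open>1 / (2 \<beta>)\<close>.  Solving the quadratic inequality gives the bound; its discriminant is
  automatically nonnegative, although \<open>Cstar\<close> may be negative.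
\<close>

lemma expected_residual:
  assumes "finite_start"
  shows "(\<integral>\<omega>. residual P (\<lambda>j. idx j \<omega>) (Suc k) \<partial>M)
    \<le> beta1 P / (1 + real k * tau0 P)
      * (norm (ystar - ydot P) + sqrt ((norm (ystar - ydot P))\<^sup>2 + 2 / beta1 P * initial_const))"
proof -
  define R where "R \<omega> = residual P (\<lambda>j. idx j \<omega>) (Suc k)" for \<omega>
  define e where "e = expectation R"
  define D where "D = norm (ystar - ydot P)"
  define b where "b = beta P (Suc k)"
  define N where "N = 1 + real k * tau0 P"
  have b: "0 < b" unfolding b_def by (rule beta_Suc_pos)
  have N: "0 < N" unfolding N_def by (rule denom_pos)
  have bN: "b = beta1 P / N" unfolding b_def beta_Suc tau_eq N_def using tau0_pos by simp
  have intR: "integrable M R" unfolding R_def by (rule integrable_path[OF residual_prefix[where P = P]])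
  \<comment> \<open>Jensen's inequality in the form \<open>R\<^sup>2 \<ge> 2 e R - e\<^sup>2\<close>.\<close>
  have "- D * R \<omega> + (2 * e * R \<omega> - e\<^sup>2) / (2 * b) \<le> gap (\<lambda>j. idx j \<omega>) (Suc k)" for \<omega>
  proof -
    have "0 \<le> (R \<omega> - e)\<^sup>2" by simp
    then have "(2 * e * R \<omega> - e\<^sup>2) / (2 * b) \<le> (R \<omega>)\<^sup>2 / (2 * b)"
      using b by (intro divide_right_mono) (simp_all add: power2_diff algebra_simps)
    then show ?thesis
      using gap_lower[OF assms, of "\<lambda>j. idx j \<omega>" k] by (simp add: R_def D_def b_def)
  qed
  then have "expectation (\<lambda>\<omega>. - D * R \<omega> + (2 * e * R \<omega> - e\<^sup>2) / (2 * b))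
      \<le> expectation (\<lambda>\<omega>. gap (\<lambda>j. idx j \<omega>) (Suc k))"
    using intR by (intro integral_mono integrable_path[OF gap_prefix]) auto
  also have "\<dots> \<le> initial_const / N" unfolding N_def by (rule expected_gap[OF assms])
  also have "expectation (\<lambda>\<omega>. - D * R \<omega> + (2 * e * R \<omega> - e\<^sup>2) / (2 * b)) = - D * e + (2 * e * e - e\<^sup>2) / (2 * b)"
    using intR by (simp add: e_def prob_space)
  finally have "- D * e + e\<^sup>2 / (2 * b) \<le> initial_const / N" by (simp add: power2_eq_square)
  then have "2 * b * (- D * e + e\<^sup>2 / (2 * b)) \<le> 2 * b * (initial_const / N)"
    using b by (intro mult_left_mono) auto
  then have "e\<^sup>2 - 2 * b * D * e \<le> 2 * b * (initial_const / N)"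
    using b by (simp add: algebra_simps)
  moreover have "2 * b * (initial_const / N) = b\<^sup>2 * (2 / beta1 P * initial_const)"
    using beta1_pos N by (simp add: bN power2_eq_square)
  ultimately have "(e - b * D)\<^sup>2 \<le> b\<^sup>2 * (D\<^sup>2 + 2 / beta1 P * initial_const)"
    by (simp add: power2_eq_square algebra_simps)
  then have "\<bar>e - b * D\<bar> \<le> sqrt (b\<^sup>2 * (D\<^sup>2 + 2 / beta1 P * initial_const))"
    by (metis real_sqrt_abs real_sqrt_le_mono)
  also have "\<dots> = b * sqrt (D\<^sup>2 + 2 / beta1 P * initial_const)"
    unfolding real_sqrt_mult using b by simp
  finally have "e \<le> b * (D + sqrt (D\<^sup>2 + 2 / beta1 P * initial_const))"
    unfolding distrib_left by linarith
  then show ?thesis unfolding bN e_def R_def D_def N_def .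
qed

end

end

theorem theorem3p4:
  fixes P :: "('p::finite, 'n::finite, 'm::finite) cd_problem"
    and M :: "'w measure"
    and idx :: "nat \<Rightarrow> 'w \<Rightarrow> 'n"
    and xstar :: "real^'p"
    and ystar :: "real^'m"
  assumes blocks_nonempty: "surj (blk P)"
    and H_spd: "block_diagonal_spd P"
    and f_pcc: "proper_closed_convex (\<lambda>x. ereal (ffun P x))"
    and f_diff: "\<And>x. ffun P differentiable (at x)"
    and f_lip: "block_lipschitz P"
    and g_not_MInf: "\<And>i z. z \<in> block_space P i \<Longrightarrow> gfun P i z \<noteq> -\<infinity>"
    and g_pcc: "proper_closed_convex (gtotal P)"
    and beta1_pos: "0 < beta1 P"
    and alpha_range: "0 \<le> alpha P" "alpha P \<le> 1"
    and q_pos: "\<And>i. 0 < qprob P i"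
    and primal_opt: "is_arg_min (objective P) (\<lambda>x. Amat P *v x = cvec P) xstar"
    and dual_opt: "is_arg_max (dual_objective P) (\<lambda>y. True) ystar"
    and strong_duality: "dual_objective P ystar = opt_value P"
    and norm_compat: "spectral_norm_compatible P"
    and prob: "prob_space M"
    and draws_indep: "prob_space.indep_vars M (\<lambda>_. count_space UNIV) idx UNIV"
    and draws_distr: "\<And>k i. measure M {\<omega> \<in> space M. idx k \<omega> = i} = qprob P i"
  shows "0 < tau0 P \<and> tau0 P \<le> 1 \<and>
    (\<forall>k\<ge>1.
       ext_expectation M (\<lambda>\<omega>. objective P (xbar P (\<lambda>j. idx j \<omega>) k) - opt_value P)
         \<le> Cstar P xstar / ereal (tau0 P * (real k - 1) + 1)
           + ereal (beta1 P * (norm (ystar - ydot P))\<^sup>2 / (2 * (tau0 P * (real k - 1) + 1)))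
           + ereal (norm ystar *
               (\<integral>\<omega>. norm (Amat P *v xbar P (\<lambda>j. idx j \<omega>) k - cvec P) \<partial>M))
       \<and>
       ereal (\<integral>\<omega>. norm (Amat P *v xbar P (\<lambda>j. idx j \<omega>) k - cvec P) \<partial>M)
         \<le> ereal (beta1 P / (tau0 P * (real k - 1) + 1)) *
           (ereal (norm (ystar - ydot P))
            + ext_sqrt (ereal ((norm (ystar - ydot P))\<^sup>2)
                        + ereal (2 / beta1 P) * Cstar P xstar)))
    \<and>
    (\<forall>k. ereal (- (norm ystar *
            (\<integral>\<omega>. norm (Amat P *v xbar P (\<lambda>j. idx j \<omega>) k - cvec P) \<partial>M)))
         \<le> ext_expectation M (\<lambda>\<omega>. objective P (xbar P (\<lambda>j. idx j \<omega>) k) - opt_value P))"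
proof -
  interpret cd_optimum P xstar ystar
    by unfold_locales (fact H_spd f_pcc f_diff f_lip g_not_MInf g_pcc beta1_pos q_pos primal_opt
        strong_duality norm_compat)+
  note draws = prob draws_indep draws_distr
  let ?E = "\<lambda>k. ext_expectation M (\<lambda>\<omega>. objective P (xbar P (\<lambda>j. idx j \<omega>) k) - opt_value P)"
  let ?R = "\<lambda>k. \<integral>\<omega>. norm (Amat P *v xbar P (\<lambda>j. idx j \<omega>) k - cvec P) \<partial>M"
  let ?D = "norm (ystar - ydot P)"
  have upper: "?E k \<le> Cstar P xstar / ereal (tau0 P * (real k - 1) + 1)
        + ereal (beta1 P * ?D\<^sup>2 / (2 * (tau0 P * (real k - 1) + 1))) + ereal (norm ystar * ?R k) \<and>
      ereal (?R k) \<le> ereal (beta1 P / (tau0 P * (real k - 1) + 1))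
        * (ereal ?D + ext_sqrt (ereal (?D\<^sup>2) + ereal (2 / beta1 P) * Cstar P xstar))"
    if k: "1 \<le> k" for k
  proof -
    obtain j where j: "k = Suc j" using k by (cases k) auto
    define N where "N = 1 + real j * tau0 P"
    have N: "0 < N" "tau0 P * (real k - 1) + 1 = N" using denom_pos by (auto simp: N_def j)
    show ?thesis
    proof (cases finite_start)
      case True
      show ?thesis
        using expected_objective_upper[OF draws True, of j] expected_residual[OF draws True, of j] N(1)
        unfolding N(2) Cstar_finite[OF True] N_def[symmetric] residual_def j[symmetric]
        by (simp add: ext_sqrt_def)
    next
      case False
      then show ?thesis
        unfolding N(2) Cstar_infinite[OF False] using N(1) beta1_pos by (simp add: ext_sqrt_def)
    qed
  qed
  have lower: "ereal (- (norm ystar * ?R k)) \<le> ?E k" for k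
    using expected_objective_lower[OF draws, of k] by (simp add: residual_def)
  from tau0_pos tau0_le_1 upper lower show ?thesis by blast
qed

end
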